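(* There exist absolute constants $C_0 > 0$ and $c > 0$ such that the following holds. Let $r, k \in \mathbb{N}$, let $s \geq C_0\sqrt{\log k}$, let $t \in \mathbb{N}$ with $t \geq s^2$, let $n \geq 2k + s\sqrt{k}$ be an integer, and let $\mathcal{F} \subset \binom{[n]}{k}$ be a family satisfying $\mu_{1/2}(\mathcal{F}^{\uparrow}) \leq 1 - 2^{-r}$ and $$|\mathcal{F}| \geq \binom{n}{k} - \binom{n-r}{k} - \binom{n-r-t}{k-1}.$$ Then there exists $R \in \binom{[n]}{r}$ such that $$|\{S \in \mathcal{F} : S \cap R = \emptyset\}| \leq 2^r e^{-c s^2}\binom{n-r}{k}.$$ (In the paper the bound is written $2^r\exp(-\Theta(s^2))\binom{n-r}{k}$.)
   Context: Logarithms are to base 2. $\binom{[n]}{k}$ denotes the set of $k$-element subsets of $[n]=\{1,\dots,n\}$. For $\mathcal{F} \subset \mathcal{P}([n])$, $\mathcal{F}^{\uparrow}$ is the up-closure of $\mathcal{F}$, i.e.\ the smallest family containing $\mathcal{F}$ that is closed under taking supersets within $[n]$. For $p \in [0,1]$, the $p$-biased measure on $\mathcal{P}([n])$ is $\mu_p(\mathcal{A}) = \sum_{S \in \mathcal{A}} p^{|S|}(1-p)^{n-|S|}$.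
   Formalization: The formal theorem assumes k ≥ 1 and adds r + t ≤ n, so the binomial coefficients have non-negative upper entries and an r-subset exists; without this (e.g. k = 2, r = n−2, s = (n−4)/√2, F all pairs, coefficient read as 0) the claim fails. *)

theory Defs
  imports Complex_Main "HOL-Library.Ramsey"
begin

definition up_closed :: "nat \<Rightarrow> nat set set \<Rightarrow> bool" where
  "up_closed n \<G> \<longleftrightarrow> (\<forall>A\<in>\<G>. \<forall>B. A \<subseteq> B \<and> B \<subseteq> {1..n} \<longrightarrow> B \<in> \<G>)"

text \<open>Meant for \<open>\<F> \<subseteq> Pow {1..n}\<close>; otherwise the intersection below is over the empty collection.\<close>
definition up_closure :: "nat \<Rightarrow> nat set set \<Rightarrow> nat set set" where
  "up_closure n \<F> = \<Inter>{\<G>. \<F> \<subseteq> \<G> \<and> \<G> \<subseteq> Pow {1..n} \<and> up_closed n \<G>}"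

definition biased_measure :: "nat \<Rightarrow> real \<Rightarrow> nat set set \<Rightarrow> real" where
  "biased_measure n p \<A> = (\<Sum>S\<in>\<A>. p ^ card S * (1 - p) ^ (n - card S))"

lemma up_closure_eq:
  assumes "\<F> \<subseteq> Pow {1..n}"
  shows "up_closure n \<F> = {T. T \<subseteq> {1..n} \<and> (\<exists>S\<in>\<F>. S \<subseteq> T)}" (is "_ = ?U")
proof
  have "\<F> \<subseteq> ?U" "?U \<subseteq> Pow {1..n}" "up_closed n ?U"
    using assms unfolding up_closed_def by blast+
  then show "up_closure n \<F> \<subseteq> ?U"
    unfolding up_closure_def by (intro Inter_lower) simp
next
  show "?U \<subseteq> up_closure n \<F>"
    unfolding up_closure_def up_closed_def by blast
qed

end

theory Submission
  imports Defs
begin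

text \<open>
  Let \<open>\<B>\<close> be the down-set of all sets containing no member of \<open>\<F>\<close>, so that
  \<open>\<mu>\<^sub>1\<^sub>/\<^sub>2(\<B>) \<ge> 2\<^sup>-\<^sup>r\<close>. By the Kruskal--Katona theorem the bound on the \<open>k\<close>-th level of
  \<open>\<B>\<close> propagates to all higher levels, and with a Chernoff bound for the levels below \<open>k\<close> it
  yields \<open>\<mu>\<^sub>p(\<B>) \<le> (1 - p)\<^sup>r + \<epsilon>\<close> for some \<open>p < 1/2\<close>, where
  \<open>\<epsilon> = exp(-\<Omega>(s\<^sup>2))\<close>. On the other hand \<open>\<mu>\<^sub>p(\<B>) \<ge> \<mu>\<^sub>1\<^sub>/\<^sub>2(\<B>)\<^sup>\<theta>\<close> with
  \<open>2\<^sup>-\<^sup>\<theta> = 1 - p\<close>, by induction on the dimension from a two-point inequality that is strict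
  unless one half of the cube misses \<open>\<B>\<close> or both halves have the same measure. Hence the deficit
  \<open>\<mu>\<^sub>p(\<B>) - \<mu>\<^sub>1\<^sub>/\<^sub>2(\<B>)\<^sup>\<theta>\<close> is at most \<open>\<epsilon>\<close>. A small deficit forces every
  coordinate to be almost irrelevant or almost decisive, and a potential argument that does not depend
  on the dimension shows that some coordinate is decisive. Removing \<open>r\<close> decisive coordinates one
  after the other gives \<open>R\<close>: almost every set avoiding \<open>R\<close> is in \<open>\<B>\<close>, and by local LYM
  the same holds on level \<open>k\<close>.
\<close>

section \<open>The two-point inequality\<close>

text \<open>By convexity: a positive value at an interior point would force a positive slope
  somewhere before it and a negative slope somewhere after it. Derivatives are asked for only inside
  the interval, because \<open>x powr \<theta>\<close> with \<open>\<theta> < 1\<close> has none at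
  0.\<close>

lemma nonpos_of_second_deriv_nonneg:
  fixes h h' h'' :: "real \<Rightarrow> real"
  assumes cont: "continuous_on {0..1} h" and "h 0 \<le> 0" "h 1 \<le> 0"
    and d1: "\<And>x. 0 < x \<Longrightarrow> x < 1 \<Longrightarrow> (h has_real_derivative h' x) (at x)"
    and d2: "\<And>x. 0 < x \<Longrightarrow> x < 1 \<Longrightarrow> (h' has_real_derivative h'' x) (at x)"
    and nonneg: "\<And>x. 0 < x \<Longrightarrow> x < 1 \<Longrightarrow> 0 \<le> h'' x"
    and x: "0 \<le> x" "x \<le> 1"
  shows "h x \<le> 0"
proof (rule ccontr)
  assume "\<not> h x \<le> 0"
  then have hx: "h x > 0" by simp
  with assms(2,3) x have x01: "0 < x" "x < 1"
    by (auto simp: less_le)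
  have diff: "h differentiable (at z)" if "0 < z" "z < 1" for z
    using d1[OF that] by (auto simp: real_differentiable_def)
  have "\<exists>l z. 0 < z \<and> z < x \<and> (h has_real_derivative l) (at z) \<and> h x - h 0 = (x - 0) * l"
    using x01 by (intro MVT continuous_on_subset[OF cont] diff) auto
  then obtain l y where y: "0 < y" "y < x" "(h has_real_derivative l) (at y)" "h x - h 0 = x * l"
    by auto
  have ly: "l = h' y" using DERIV_unique[OF y(3) d1] y x01 by auto
  have "\<exists>l z. x < z \<and> z < 1 \<and> (h has_real_derivative l) (at z) \<and> h 1 - h x = (1 - x) * l"
    using x01 by (intro MVT continuous_on_subset[OF cont] diff) auto
  then obtain m z where z: "x < z" "z < 1" "(h has_real_derivative m) (at z)" "h 1 - h x = (1 - x) * m"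
    by auto
  have mz: "m = h' z" using DERIV_unique[OF z(3) d1] z x01 by auto
  have "x * l > 0" using y(4) hx assms(2) by linarith
  then have "h' y > 0" using x01 ly by (simp add: zero_less_mult_iff)
  moreover have "(1 - x) * m < 0" using z(4) hx assms(3) by linarith
  then have "h' z < 0" using x01 mz by (simp add: mult_less_0_iff)
  moreover have "h' y \<le> h' z"
  proof (rule DERIV_nonneg_imp_nondecreasing[of y z h'])
    fix w assume "y \<le> w" "w \<le> z"
    then have "0 < w" "w < 1" using y z by auto
    then show "\<exists>l. (h' has_real_derivative l) (at w) \<and> 0 \<le> l" using d2 nonneg by blast
  qed (use y z in auto)
  ultimately show False by linarith
qed

text \<open>This exponent sends 1/2 to \<open>1 - p\<close>. The sets avoiding \<open>r\<close>
  given points have measures \<open>(1/2) ^ r\<close> and \<open>(1 - p) ^ r\<close>, so they turn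
  the comparison of the two measures into an equality. The bound 3/8 keeps \<open>p - 1/4\<close> at
  least 1/8 in the second derivative estimate.\<close>

locale biased_exponent =
  fixes p \<theta> :: real
  assumes p: "3/8 \<le> p" "p < 1/2" and \<theta>: "\<theta> = log 2 (1 / (1 - p))"
begin

lemma half_powr_exponent: "(1/2) powr \<theta> = 1 - p"
  using p by (simp add: \<theta> powr_def log_def ln_div)

lemma exponent_ge_half: "1/2 \<le> \<theta>"
proof -
  have "sqrt 2 \<le> 1 / (1 - p)"
  proof (rule real_le_lsqrt)
    have "8/5 \<le> 1 / (1 - p)" using p by (simp add: field_simps)
    then have "(8/5)\<^sup>2 \<le> (1 / (1 - p))\<^sup>2" by (intro power_mono) auto
    then show "2 \<le> (1 / (1 - p))\<^sup>2" by (simp add: power2_eq_square)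
  qed (use p in auto)
  then have "2 powr (1/2) \<le> 1 / (1 - p)" by (simp add: powr_half_sqrt)
  then show ?thesis using p unfolding \<theta> by (subst le_log_iff) auto
qed

text \<open>With \<open>y = 1 - 2 * p\<close> this is the chord bound
  \<open>2 powr y \<le> 1 + y\<close> on the unit interval. It keeps \<open>1 - \<theta>\<close> at
  least \<open>1 - 2 * p\<close>, which is the source of the gain in the two-point
  inequality.\<close>

lemma exponent_le: "\<theta> \<le> 2 * p"
proof -
  define y where "y = 1 - 2 * p"
  have y: "0 \<le> y" "y \<le> 1" using p by (auto simp: y_def)
  have "1 - \<theta> = log 2 (1 + y)"
  proof -
    have "1 + y = 2 * (1 - p)" by (simp add: y_def)
    then have "log 2 (1 + y) = 1 + log 2 (1 - p)" using p by (simp only:) (subst log_mult_pos, auto)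
    then show ?thesis using p by (simp add: \<theta> log_divide_pos)
  qed
  moreover have "y \<le> log 2 (1 + y)"
  proof -
    have "2 powr y - 1 - y \<le> 0"
    proof (rule nonpos_of_second_deriv_nonneg[where h = "\<lambda>y. 2 powr y - 1 - y"
        and h' = "\<lambda>y. 2 powr y * ln 2 - 1" and h'' = "\<lambda>y. 2 powr y * ln 2 * ln 2"])
      show "continuous_on {0..1} (\<lambda>y::real. 2 powr y - 1 - y)" by (intro continuous_intros) auto
      show "((\<lambda>y. 2 powr y - 1 - y) has_real_derivative 2 powr x * ln 2 - 1) (at x)" for x :: real
        by (auto intro!: derivative_eq_intros)
      show "((\<lambda>y. 2 powr y * ln 2 - 1) has_real_derivative 2 powr x * ln 2 * ln 2) (at x)" for x :: real
        by (auto intro!: derivative_eq_intros)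
    qed (use y in auto)
    then show ?thesis using y by (subst le_log_iff) auto
  qed
  ultimately show ?thesis by (simp add: y_def)
qed

text \<open>The difference of the two sides vanishes at 0 and, by the choice of
  \<open>\<theta>\<close>, at 1 as well as for the half cube; between these points convexity of left
  minus right decides the sign.\<close>

lemma powr_two_point_unit:
  assumes x: "0 \<le> x" "x \<le> 1"
  shows "(1/2 - p) / 16 * (x * (1 - x)) \<le> (1 - p) + p * x powr \<theta> - ((1 + x) / 2) powr \<theta>"
proof -
  note th1 = exponent_ge_half and q = half_powr_exponent
  have th2: "1 - \<theta> \<ge> 1 - 2 * p" using exponent_le by simp
  have th3: "\<theta> < 1" using th2 p by linarith
  \<comment> \<open>The factor 1/16 makes \<open>2 * c\<close> equal to
    \<open>(1 - 2 * p) / 16\<close>, the lower bound found below for the rest of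
    \<open>h''\<close>.\<close>
  define c where "c = (1/2 - p) / 16"
  define h where "h = (\<lambda>x. c * (x * (1 - x)) - ((1 - p) + p * x powr \<theta> - ((1 + x) / 2) powr \<theta>))"
  define h' where "h' = (\<lambda>x. c * (1 - 2 * x) - (p * (\<theta> * x powr (\<theta> - 1)) - \<theta> * ((1 + x) / 2) powr (\<theta> - 1) * (1/2)))"
  define h'' where "h'' = (\<lambda>x. - 2 * c + \<theta> * (1 - \<theta>) * (p * x powr (\<theta> - 2) - ((1 + x) / 2) powr (\<theta> - 2) * (1/4)))"
  have "h x \<le> 0"
  proof (rule nonpos_of_second_deriv_nonneg[of h h' h''])
    show "continuous_on {0..1} h"
      unfolding h_def using th1 by (intro continuous_intros continuous_on_powr') auto
    show "h 0 \<le> 0" "h 1 \<le> 0" by (auto simp: h_def q)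
  next
    fix x :: real assume x: "0 < x" "x < 1"
    show "(h has_real_derivative h' x) (at x)"
      unfolding h_def h'_def using x
      by (auto intro!: derivative_eq_intros simp: algebra_simps)
    show "(h' has_real_derivative h'' x) (at x)"
      unfolding h'_def h''_def using x
      by (auto intro!: derivative_eq_intros simp: algebra_simps add_divide_distrib diff_divide_distrib)
    have "((1 + x) / 2) powr (\<theta> - 2) \<le> x powr (\<theta> - 2)"
      using x th3 by (intro powr_mono2') auto
    moreover have "1 \<le> x powr (\<theta> - 2)"
      using x th3 powr_mono2'[of "\<theta> - 2" x 1] by simp
    ultimately have i1: "1/8 \<le> p * x powr (\<theta> - 2) - ((1 + x) / 2) powr (\<theta> - 2) * (1/4)"
      using mult_right_mono[OF p(1), of "x powr (\<theta> - 2)"] by linarith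
    have i2: "(1/2) * (1 - 2 * p) \<le> \<theta> * (1 - \<theta>)"
      using th1 th2 p by (intro mult_mono) auto
    have "(1/2) * (1 - 2 * p) * (1/8) \<le> \<theta> * (1 - \<theta>) * (p * x powr (\<theta> - 2) - ((1 + x) / 2) powr (\<theta> - 2) * (1/4))"
      using p th1 th3 by (intro mult_mono[OF i2 i1]) auto
    then show "0 \<le> h'' x" unfolding h''_def c_def using p by (simp add: field_simps)
  qed (use x in auto)
  then show ?thesis by (simp add: h_def c_def)
qed

text \<open>The inequality for \<open>x = b / a\<close>, multiplied by
  \<open>a powr \<theta>\<close>. Since \<open>a \<le> 1\<close> and
  \<open>\<theta> \<le> 1\<close>, this factor is at least \<open>a\<close>, so the gain survives
  with the plain factor \<open>a\<close>.\<close>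

lemma powr_two_point:
  assumes ab: "0 \<le> b" "b \<le> a" "a \<le> 1"
  shows "(1/2 - p) / 16 * (b * (a - b) / a) \<le> (1 - p) * a powr \<theta> + p * b powr \<theta> - ((a + b) / 2) powr \<theta>"
proof (cases "a = 0")
  case False
  with ab have a: "0 < a" by simp
  define x where "x = b / a"
  have x: "0 \<le> x" "x \<le> 1" "b = x * a" using a ab by (auto simp: x_def)
  have h: "(a + b) / 2 = ((1 + x) / 2) * a" by (simp add: x(3) field_simps)
  have "a powr 1 \<le> a powr \<theta>" using a ab exponent_le p by (intro powr_mono') auto
  then have "a \<le> a powr \<theta>" using a by simp
  then have "a * ((1/2 - p) / 16 * (x * (1 - x))) \<le> a powr \<theta> * ((1/2 - p) / 16 * (x * (1 - x)))"
    using x p by (intro mult_right_mono) auto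
  also have "\<dots> \<le> a powr \<theta> * ((1 - p) + p * x powr \<theta> - ((1 + x) / 2) powr \<theta>)"
    by (intro mult_left_mono powr_two_point_unit x) auto
  also have "\<dots> = (1 - p) * a powr \<theta> + p * b powr \<theta> - ((a + b) / 2) powr \<theta>"
  proof -
    have "((a + b) / 2) powr \<theta> = ((1 + x) / 2) powr \<theta> * a powr \<theta>"
      unfolding h using a x by (subst powr_mult) auto
    moreover have "b powr \<theta> = x powr \<theta> * a powr \<theta>" using a x by (simp add: powr_mult)
    ultimately show ?thesis by (simp add: algebra_simps)
  qed
  also have "a * ((1/2 - p) / 16 * (x * (1 - x))) = (1/2 - p) / 16 * (b * (a - b) / a)"
    using a by (simp add: x(3) field_simps)
  finally show ?thesis .
qed (use ab in auto)

end

section \<open>The Kruskal--Katona theorem with two cascade terms\<close>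

definition shadow :: "'a set set \<Rightarrow> 'a set set" where
  "shadow \<F> = {S - {x} | S x. S \<in> \<F> \<and> x \<in> S}"

lemma shadowI: "S \<in> \<F> \<Longrightarrow> x \<in> S \<Longrightarrow> S - {x} \<in> shadow \<F>"
  by (auto simp: shadow_def)

lemma shadowE:
  assumes "T \<in> shadow \<F>"
  obtains S x where "S \<in> \<F>" "x \<in> S" "T = S - {x}"
  using assms by (auto simp: shadow_def)

lemma shadowI_insert: "insert x T \<in> \<F> \<Longrightarrow> x \<notin> T \<Longrightarrow> T \<in> shadow \<F>"
  using shadowI[of "insert x T" \<F> x] by simp

lemma shadowE_insert:
  assumes "T \<in> shadow \<F>"
  obtains x where "insert x T \<in> \<F>" "x \<notin> T"
  using assms by (elim shadowE) (metis Diff_iff insertCI insert_Diff)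

section \<open>Compressions replacing \<open>j\<close> by \<open>v\<close>\<close>

definition shift :: "'a \<Rightarrow> 'a \<Rightarrow> 'a set set \<Rightarrow> 'a set set" where
  "shift v j \<F> = {T.
     if v \<in> T \<and> j \<notin> T then T \<in> \<F> \<or> insert j (T - {v}) \<in> \<F>
     else if j \<in> T \<and> v \<notin> T then T \<in> \<F> \<and> insert v (T - {j}) \<in> \<F>
     else T \<in> \<F>}"

lemma swap_insert_Diff: "v \<in> T \<Longrightarrow> j \<notin> T \<Longrightarrow> v \<noteq> j \<Longrightarrow> insert v (insert j (T - {v}) - {j}) = T"
  by auto

text \<open>A member of the shifted family outside \<open>\<F>\<close> can only come from a swap,
  and undoing that swap inverts the map.\<close>

lemma bij_betw_shift:
  assumes "v \<noteq> j"
  shows "bij_betw (\<lambda>S. if j \<in> S \<and> v \<notin> S \<and> insert v (S - {j}) \<notin> \<F> then insert v (S - {j}) else S)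
    \<F> (shift v j \<F>)"
proof (rule bij_betw_byWitness[where f' = "\<lambda>T. if T \<in> \<F> then T else insert j (T - {v})"])
  show "\<forall>S\<in>\<F>. (\<lambda>T. if T \<in> \<F> then T else insert j (T - {v}))
    (if j \<in> S \<and> v \<notin> S \<and> insert v (S - {j}) \<notin> \<F> then insert v (S - {j}) else S) = S"
    using assms by (auto simp: swap_insert_Diff)
  show "\<forall>T\<in>shift v j \<F>. (\<lambda>S. if j \<in> S \<and> v \<notin> S \<and> insert v (S - {j}) \<notin> \<F> then insert v (S - {j}) else S)
    (if T \<in> \<F> then T else insert j (T - {v})) = T"
    using assms by (auto simp: shift_def swap_insert_Diff insert_absorb split: if_splits)
  show "(\<lambda>S. if j \<in> S \<and> v \<notin> S \<and> insert v (S - {j}) \<notin> \<F> then insert v (S - {j}) else S) ` \<F> \<subseteq> shift v j \<F>"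
    using assms by (auto simp: shift_def swap_insert_Diff insert_absorb)
  show "(\<lambda>T. if T \<in> \<F> then T else insert j (T - {v})) ` shift v j \<F> \<subseteq> \<F>"
    using assms by (auto simp: shift_def split: if_splits)
qed

lemma card_shift: "v \<noteq> j \<Longrightarrow> card (shift v j \<F>) = card \<F>"
  by (rule sym, rule bij_betw_same_card, rule bij_betw_shift)

text \<open>Let \<open>x\<close> be the element whose addition to \<open>T\<close> gives a shifted
  set. If \<open>x\<close> is neither \<open>v\<close> nor \<open>j\<close>, the swap commutes with
  adding \<open>x\<close>. If it is one of them, the enlarged set either contains both points, hence
  lies in \<open>\<F>\<close>, or differs from a member of \<open>\<F>\<close> at most by the swap,
  and removing the right point gives the required shadow sets.\<close>

lemma shadow_shift_subset:
  assumes "v \<noteq> j"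
  shows "shadow (shift v j \<F>) \<subseteq> shift v j (shadow \<F>)"
proof
  fix T assume "T \<in> shadow (shift v j \<F>)"
  then obtain x where x: "insert x T \<in> shift v j \<F>" "x \<notin> T" by (rule shadowE_insert)
  note I = shadowI_insert[of _ _ \<F>]
  consider "v \<in> T" "j \<in> T" | "v \<in> T" "j \<notin> T" | "v \<notin> T" "j \<in> T" | "v \<notin> T" "j \<notin> T" by blast
  then show "T \<in> shift v j (shadow \<F>)"
  proof cases
    case 1
    then show ?thesis using x I[of x T] by (auto simp: shift_def)
  next
    case 2
    show ?thesis
    proof (cases "x = j")
      case True
      then show ?thesis using 2 x I[of j T] by (auto simp: shift_def)
    next
      case False
      have "insert j (insert x T - {v}) = insert x (insert j (T - {v}))" using 2 x by auto
      then show ?thesis using 2 x False I[of x T] I[of x "insert j (T - {v})"]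
        by (auto simp: shift_def)
    qed
  next
    case 3
    show ?thesis
    proof (cases "x = v")
      case True
      have "insert v T = insert j (insert v (T - {j}))" using 3 by auto
      then show ?thesis using 3 x True assms I[of v T] I[of j "insert v (T - {j})"]
        by (auto simp: shift_def)
    next
      case False
      have "insert v (insert x T - {j}) = insert x (insert v (T - {j}))" using 3 x by auto
      then show ?thesis using 3 x False I[of x T] I[of x "insert v (T - {j})"]
        by (auto simp: shift_def)
    qed
  next
    case 4
    then have "insert x T \<in> \<F> \<or> insert j T \<in> \<F>"
      using x assms by (cases "x = v"; cases "x = j") (simp_all add: shift_def)
    then have "T \<in> shadow \<F>" using 4 x(2) I by blast
    then show ?thesis using 4 by (simp add: shift_def)
  qed
qed

lemma finite_shadow:
  assumes "finite V" "\<F> \<subseteq> Pow V"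
  shows "finite (shadow \<F>)"
  by (rule finite_subset[of _ "Pow V"]) (use assms in \<open>auto simp: shadow_def\<close>)

lemma finite_shift:
  assumes "finite \<F>" "v \<noteq> j" shows "finite (shift v j \<F>)"
  using bij_betw_finite[OF bij_betw_shift[OF assms(2)]] assms(1) by blast

lemma insert_in_nsets:
  "finite W \<Longrightarrow> W \<subseteq> V \<Longrightarrow> Suc (card W) = l \<Longrightarrow> v \<in> V \<Longrightarrow> v \<notin> W \<Longrightarrow> insert v W \<in> nsets V l"
  by (auto simp: nsets_def)

text \<open>A family with the fewest sets avoiding \<open>v\<close>, among those of the same size with no larger
  shadow, is stable under all shifts towards \<open>v\<close>.\<close>

lemma exists_shifted_family:
  assumes "finite V" "v \<in> V" "\<F> \<subseteq> nsets V l"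
  obtains \<G> where "\<G> \<subseteq> nsets V l" "card \<G> = card \<F>" "card (shadow \<G>) \<le> card (shadow \<F>)"
    "\<And>S j. S \<in> \<G> \<Longrightarrow> j \<in> S \<Longrightarrow> v \<notin> S \<Longrightarrow> insert v (S - {j}) \<in> \<G>"
proof -
  define P where "P = (\<lambda>\<G>. \<G> \<subseteq> nsets V l \<and> card \<G> = card \<F> \<and> card (shadow \<G>) \<le> card (shadow \<F>))"
  obtain \<G> where G: "P \<G>" "\<And>\<H>. P \<H> \<Longrightarrow> card {S \<in> \<G>. v \<notin> S} \<le> card {S \<in> \<H>. v \<notin> S}"
    using ex_has_least_nat[of P \<F> "\<lambda>\<G>. card {S \<in> \<G>. v \<notin> S}"] assms(3) by (auto simp: P_def)
  have fin: "finite \<G>"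
    using G(1) finite_imp_finite_nsets[OF assms(1)] by (auto simp: P_def intro: finite_subset)
  have GV: "\<G> \<subseteq> Pow V" using G(1) by (auto simp: P_def nsets_def)
  have "insert v (S - {j}) \<in> \<G>" if S: "S \<in> \<G>" "j \<in> S" "v \<notin> S" for S j
  proof (rule ccontr)
    assume *: "insert v (S - {j}) \<notin> \<G>"
    have vj: "v \<noteq> j" using S by auto
    have "shift v j \<G> \<subseteq> nsets V l"
    proof
      fix T assume T: "T \<in> shift v j \<G>"
      show "T \<in> nsets V l"
      proof (cases "T \<in> \<G>")
        case True
        then show ?thesis using G(1) by (auto simp: P_def)
      next
        case False
        then have T': "v \<in> T" "j \<notin> T" "insert j (T - {v}) \<in> \<G>"
          using T by (auto simp: shift_def split: if_splits)
        then have "insert j (T - {v}) \<in> nsets V l" using G(1) by (auto simp: P_def)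
        then have "finite (T - {v})" "T - {v} \<subseteq> V" "Suc (card (T - {v})) = l"
          using T' by (auto simp: nsets_def)
        moreover have "T = insert v (T - {v})" using T' by auto
        ultimately show ?thesis
          using insert_in_nsets[of "T - {v}" V l v] assms(2) by simp
      qed
    qed
    moreover have "card (shadow (shift v j \<G>)) \<le> card (shift v j (shadow \<G>))"
      by (intro card_mono shadow_shift_subset vj finite_shift finite_shadow[OF assms(1) GV])
    ultimately have "P (shift v j \<G>)" using G(1) by (auto simp: P_def card_shift[OF vj])
    then have "card {S \<in> \<G>. v \<notin> S} \<le> card {S \<in> shift v j \<G>. v \<notin> S}" by (rule G(2))
    moreover have "S \<notin> shift v j \<G>" using S * by (simp add: shift_def)
    then have "{S \<in> shift v j \<G>. v \<notin> S} \<subset> {S \<in> \<G>. v \<notin> S}"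
      using S by (auto simp: shift_def)
    then have "card {S \<in> shift v j \<G>. v \<notin> S} < card {S \<in> \<G>. v \<notin> S}"
      using fin by (intro psubset_card_mono) auto
    ultimately show False by simp
  qed
  then show ?thesis using that G(1) by (auto simp: P_def)
qed


text \<open>The case of graphs: more than \<open>a choose 2\<close> edges span more than
  \<open>a\<close> vertices, and the shadow contains the singleton of each of them. It serves as the
  bottom of the induction below.\<close>

lemma card_shadow_of_pairs:
  assumes "finite V" "\<F> \<subseteq> nsets V 2" "a choose 2 < card \<F>"
  shows "a < card (shadow \<F>)"
proof -
  have U: "\<Union>\<F> \<subseteq> V" using assms(2) by (auto simp: nsets_def)
  then have fin: "finite (\<Union>\<F>)" using assms(1) finite_subset by blast
  have "\<F> \<subseteq> nsets (\<Union>\<F>) 2" using assms(2) by (auto simp: nsets_def)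
  then have "card \<F> \<le> card (\<Union>\<F>) choose 2"
    using card_mono[OF finite_imp_finite_nsets[OF fin]] by (simp add: card_nsets)
  with assms(3) have "a choose 2 < card (\<Union>\<F>) choose 2" by simp
  then have "a < card (\<Union>\<F>)" by (meson binomial_right_mono leD leI)
  also have "card (\<Union>\<F>) = card ((\<lambda>x. {x}) ` \<Union>\<F>)" by (simp add: card_image)
  also have "\<dots> \<le> card (shadow \<F>)"
  proof (rule card_mono)
    show "finite (shadow \<F>)" using assms by (intro finite_shadow[of V]) (auto simp: nsets_def)
    show "(\<lambda>x. {x}) ` \<Union>\<F> \<subseteq> shadow \<F>"
    proof safe
      fix x S assume S: "S \<in> \<F>" "x \<in> S"
      then have "card S = 2" using assms(2) by (auto simp: nsets_def)
      then obtain y where "S = {x, y}" "x \<noteq> y" using S(2) by (auto simp: card_2_iff)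
      then show "{x} \<in> shadow \<F>" using S(1) by (intro shadowI_insert[of y]) (auto simp: insert_commute)
    qed
  qed
  finally show ?thesis .
qed

text \<open>Pascal's rule with truncated \<open>a - 1\<close>. For \<open>a = 0\<close> and
  \<open>m = 1\<close> the right side is 1 and the left side 0, so only this direction holds there;
  the reverse one starts at \<open>m = 2\<close>.\<close>

lemma choose_le_pascal: "1 \<le> m \<Longrightarrow> a choose m \<le> ((a - 1) choose m) + ((a - 1) choose (m - 1))"
  by (cases a; cases m) auto

lemma pascal_le_choose: "2 \<le> m \<Longrightarrow> ((a - 1) choose m) + ((a - 1) choose (m - 1)) \<le> a choose m"
  by (cases a; cases m) (auto simp: binomial_eq_0)

text \<open>The first two terms of the Kruskal--Katona cascade, by Frankl's argument: after shifting
  towards \<open>v\<close>, the link of \<open>v\<close> contains the shadow of the sets avoiding \<open>v\<close>.\<close>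

theorem kruskal_katona_two_terms:
  assumes "finite V" "\<F> \<subseteq> nsets V l" "3 \<le> l" "(a choose l) + (b choose (l - 1)) < card \<F>"
  shows "(a choose (l - 1)) + (b choose (l - 2)) < card (shadow \<F>)"
  using assms
proof (induction V arbitrary: \<F> l a b rule: finite_induct)
  case empty
  then have "\<F> = {}" by (auto simp: nsets_def)
  then show ?case using empty by simp
next
  case (insert v V)
  obtain \<G> where G: "\<G> \<subseteq> nsets (insert v V) l" "card \<G> = card \<F>" "card (shadow \<G>) \<le> card (shadow \<F>)"
    and stable: "\<And>S j. S \<in> \<G> \<Longrightarrow> j \<in> S \<Longrightarrow> v \<notin> S \<Longrightarrow> insert v (S - {j}) \<in> \<G>"
    using exists_shifted_family[of "insert v V" v \<F> l] insert by auto
  define L where "L = {S. v \<notin> S \<and> insert v S \<in> \<G>}"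
  define D where "D = {S \<in> \<G>. v \<notin> S}"
  have finG: "finite \<G>" using G(1) insert.hyps by (meson finite.insertI finite_imp_finite_nsets finite_subset)
  have L: "L \<subseteq> nsets V (l - 1)"
  proof
    fix S assume "S \<in> L"
    then have "v \<notin> S" "insert v S \<in> nsets (insert v V) l" using G(1) by (auto simp: L_def)
    then show "S \<in> nsets V (l - 1)" by (auto simp: nsets_def)
  qed
  have D: "D \<subseteq> nsets V l" using G(1) by (auto simp: D_def nsets_def)
  have finL: "finite L" "finite D"
    using L D insert.hyps by (meson finite_imp_finite_nsets finite_subset)+
  have LP: "L \<subseteq> Pow V" and DP: "D \<subseteq> Pow V" using L D by (auto simp: nsets_def)
  have injv: "inj_on (insert v) (Pow V)"
    using insert.hyps by (auto simp: inj_on_def)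
  have "\<G> = insert v ` L \<union> D"
  proof (rule antisym; rule subsetI)
    fix S assume "S \<in> \<G>"
    moreover have "S - {v} \<in> L" "S = insert v (S - {v})" if "v \<in> S"
      using \<open>S \<in> \<G>\<close> that by (auto simp: L_def insert_absorb)
    ultimately show "S \<in> insert v ` L \<union> D" by (cases "v \<in> S") (blast, simp add: D_def)
  qed (auto simp: L_def D_def)
  moreover have "insert v ` L \<inter> D = {}" by (auto simp: D_def)
  ultimately have cardG: "card \<G> = card L + card D"
    using finL inj_on_subset[OF injv LP] by (simp add: card_Un_disjoint card_image)
  have "shadow D \<subseteq> L"
  proof
    fix T assume "T \<in> shadow D"
    then obtain S x where "S \<in> D" "x \<in> S" "T = S - {x}" by (rule shadowE)
    then show "T \<in> L" using stable by (auto simp: D_def L_def)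
  qed
  then have shD: "card (shadow D) \<le> card L" using finL by (intro card_mono)
  have shG: "card L + card (shadow L) \<le> card (shadow \<G>)"
  proof -
    have sub: "shadow L \<subseteq> Pow V" using LP by (auto simp: shadow_def)
    have fin: "finite (shadow L)" using finite_shadow[OF insert.hyps(1) LP] .
    have "L \<union> insert v ` shadow L \<subseteq> shadow \<G>"
    proof (intro Un_least subsetI)
      fix S assume "S \<in> L" then show "S \<in> shadow \<G>" by (auto simp: L_def intro: shadowI_insert)
    next
      fix S assume "S \<in> insert v ` shadow L"
      then obtain T x where T: "S = insert v T" "insert x T \<in> L" "x \<notin> T"
        by (auto elim: shadowE_insert)
      then show "S \<in> shadow \<G>"
        by (intro shadowI_insert[of x]) (auto simp: L_def insert_commute)
    qed
    moreover have "L \<inter> insert v ` shadow L = {}" by (auto simp: L_def)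
    moreover have "finite (shadow \<G>)"
      using G(1) insert.hyps by (intro finite_shadow[of "insert v V"]) (auto simp: nsets_def)
    ultimately have "card (L \<union> insert v ` shadow L) \<le> card (shadow \<G>)" by (intro card_mono)
    then show ?thesis using \<open>L \<inter> _ = {}\<close> fin finL inj_on_subset[OF injv sub]
      by (simp add: card_Un_disjoint card_image)
  qed
  have l: "2 \<le> l" "2 \<le> l - 1" "1 \<le> l - 1" "1 \<le> l - 2" "l - 1 - 1 = l - 2" "l - 2 - 1 = l - 3" "l - 1 - 2 = l - 3"
    using insert.prems(2) by auto
  \<comment> \<open>If the link were this small, the sets avoiding \<open>v\<close> would exceed the
    cascade for \<open>a - 1\<close> and \<open>b - 1\<close>; by induction their shadow would be
    too large to fit into \<open>L\<close>.\<close>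
  have less: "((a - 1) choose (l - 1)) + ((b - 1) choose (l - 2)) < card L"
  proof (rule ccontr)
    assume *: "\<not> ?thesis"
    have "((a - 1) choose l) + ((b - 1) choose (l - 1)) < card D"
      using * cardG G(2) insert.prems(3) pascal_le_choose[OF l(1), of a]
        pascal_le_choose[OF l(2), of b, unfolded l(5)] by linarith
    from insert.IH[OF D insert.prems(2) this] show False using * shD by linarith
  qed
  \<comment> \<open>For \<open>l = 3\<close> the link is a graph and the second term is 1, which the
    strict inequality for pairs absorbs.\<close>
  have "((a - 1) choose (l - 2)) + ((b - 1) choose (l - 3)) \<le> card (shadow L)"
  proof (cases "l = 3")
    case True
    then show ?thesis using card_shadow_of_pairs[OF insert.hyps(1), of L "a - 1"] L less by simp
  next
    case False
    then have "3 \<le> l - 1" using insert.prems by simp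
    from insert.IH[OF L this, of "a - 1" "b - 1", unfolded l(5,7)] less show ?thesis
      by linarith
  qed
  with less shG G(3) choose_le_pascal[OF l(3), of a, unfolded l(5)]
    choose_le_pascal[OF l(4), of b, unfolded l(6)]
  show ?case by linarith
qed

section \<open>Biased measures of down-sets\<close>

text \<open>Only the subsets of \<open>V\<close> in \<open>\<B>\<close> are counted, without
  requiring \<open>\<B>\<close> to live on \<open>V\<close>. Thus the half of the cube where
  \<open>i\<close> is absent is measured by shrinking \<open>V\<close> while keeping
  \<open>\<B>\<close>.\<close>

definition pmeas :: "real \<Rightarrow> 'a set \<Rightarrow> 'a set set \<Rightarrow> real" where
  "pmeas p V \<B> = (\<Sum>S\<in>{S \<in> \<B>. S \<subseteq> V}. p ^ card S * (1 - p) ^ (card V - card S))"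

text \<open>The usual condition \<open>i \<notin> S\<close> is left to the ground set of
  \<open>pmeas\<close>; in this form links commute and stay inside a down-set without side
  conditions.\<close>

definition link :: "'a \<Rightarrow> 'a set set \<Rightarrow> 'a set set" where
  "link i \<B> = {S. insert i S \<in> \<B>}"

definition down_closed :: "'a set set \<Rightarrow> bool" where
  "down_closed \<B> \<longleftrightarrow> (\<forall>S\<in>\<B>. \<forall>T\<subseteq>S. T \<in> \<B>)"

lemma down_closed_link: "down_closed \<B> \<Longrightarrow> down_closed (link i \<B>)"
  unfolding down_closed_def link_def by (auto intro: insert_mono)

lemma link_subset: "down_closed \<B> \<Longrightarrow> link i \<B> \<subseteq> \<B>"
  unfolding down_closed_def link_def by blast

lemma link_commute: "link i (link j \<B>) = link j (link i \<B>)"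
  by (simp add: link_def insert_commute)

lemma pmeas_empty: "pmeas p {} \<B> = (if {} \<in> \<B> then 1 else 0)"
proof -
  have "{S \<in> \<B>. S \<subseteq> {}} = (if {} \<in> \<B> then {{}} else {})" by auto
  then show ?thesis by (simp add: pmeas_def)
qed

lemma pmeas_insert:
  assumes "finite V" "i \<notin> V"
  shows "pmeas p (insert i V) \<B> = (1 - p) * pmeas p V \<B> + p * pmeas p V (link i \<B>)"
proof -
  let ?L = "{S \<in> link i \<B>. S \<subseteq> V}"
  have eq: "{S \<in> \<B>. S \<subseteq> insert i V} = {S \<in> \<B>. S \<subseteq> V} \<union> insert i ` ?L"
  proof (rule antisym; rule subsetI)
    fix S assume S: "S \<in> {S \<in> \<B>. S \<subseteq> insert i V}"
    have "S - {i} \<in> ?L" "S = insert i (S - {i})" if "i \<in> S"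
      using S that by (auto simp: link_def insert_absorb)
    then show "S \<in> {S \<in> \<B>. S \<subseteq> V} \<union> insert i ` ?L" using S by (cases "i \<in> S") blast+
  qed (auto simp: link_def)
  have inj: "inj_on (insert i) ?L" using assms(2) by (auto simp: inj_on_def)
  have c1: "p ^ card S * (1 - p) ^ (card (insert i V) - card S) = (1 - p) * (p ^ card S * (1 - p) ^ (card V - card S))"
    if "S \<subseteq> V" for S
    using card_mono[OF assms(1) that] assms by (simp add: Suc_diff_le)
  have c2: "p ^ card (insert i S) * (1 - p) ^ (card (insert i V) - card (insert i S)) = p * (p ^ card S * (1 - p) ^ (card V - card S))"
    if "S \<subseteq> V" for S
    using that assms finite_subset[OF that] by (subst card_insert_disjoint, blast, blast)+ simp
  have "pmeas p (insert i V) \<B> = (\<Sum>S\<in>{S \<in> \<B>. S \<subseteq> V}. p ^ card S * (1 - p) ^ (card (insert i V) - card S))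
     + (\<Sum>S\<in>insert i ` ?L. p ^ card S * (1 - p) ^ (card (insert i V) - card S))"
    unfolding pmeas_def eq using assms by (intro sum.union_disjoint) auto
  also have "\<dots> = (1 - p) * pmeas p V \<B> + p * pmeas p V (link i \<B>)"
    by (simp add: sum.reindex[OF inj] c1 c2 pmeas_def sum_distrib_left cong: sum.cong_simp)
  finally show ?thesis .
qed

lemma pmeas_remove:
  assumes "finite V" "i \<in> V"
  shows "pmeas p V \<B> = (1 - p) * pmeas p (V - {i}) \<B> + p * pmeas p (V - {i}) (link i \<B>)"
  using pmeas_insert[of "V - {i}" i p \<B>] assms by (simp add: insert_absorb)

lemma pmeas_half_remove:
  assumes "finite V" "i \<in> V"
  shows "pmeas (1/2) V \<B> = (pmeas (1/2) (V - {i}) \<B> + pmeas (1/2) (V - {i}) (link i \<B>)) / 2"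
  using pmeas_remove[OF assms, of "1/2"] by simp

lemma pmeas_mono:
  assumes "finite V" "0 \<le> p" "p \<le> 1" "\<And>S. S \<in> \<A> \<Longrightarrow> S \<subseteq> V \<Longrightarrow> S \<in> \<B>"
  shows "pmeas p V \<A> \<le> pmeas p V \<B>"
  unfolding pmeas_def using assms by (intro sum_mono2) auto

lemma pmeas_nonneg: "0 \<le> p \<Longrightarrow> p \<le> 1 \<Longrightarrow> 0 \<le> pmeas p V \<B>"
  unfolding pmeas_def by (intro sum_nonneg) auto

lemma pmeas_UNIV: "finite V \<Longrightarrow> pmeas p V UNIV = 1"
proof (induction V rule: finite_induct)
  case (insert i V)
  have "link i UNIV = (UNIV :: 'a set set)" by (auto simp: link_def)
  then show ?case using insert by (simp add: pmeas_insert)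
qed (simp add: pmeas_empty)

lemma pmeas_le_1: "finite V \<Longrightarrow> 0 \<le> p \<Longrightarrow> p \<le> 1 \<Longrightarrow> pmeas p V \<B> \<le> 1"
  using pmeas_mono[of V p \<B> UNIV] by (simp add: pmeas_UNIV)

lemma pmeas_link_le:
  "finite V \<Longrightarrow> 0 \<le> p \<Longrightarrow> p \<le> 1 \<Longrightarrow> down_closed \<B> \<Longrightarrow> pmeas p V (link i \<B>) \<le> pmeas p V \<B>"
  using link_subset[of \<B> i] by (intro pmeas_mono) auto

section \<open>The deficit in the comparison of biased and uniform measure\<close>

context biased_exponent
begin

text \<open>The deficit vanishes if \<open>\<B>\<close> consists of the sets avoiding a fixed subset of \<open>V\<close>.\<close>

definition deficit :: "'a set \<Rightarrow> 'a set set \<Rightarrow> real" where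
  "deficit V \<B> = pmeas p V \<B> - pmeas (1/2) V \<B> powr \<theta>"

text \<open>Biased measure averages over the two halves with weights \<open>1 - p\<close> and
  \<open>p\<close>, uniform measure with weights 1/2; the two-point inequality for \<open>a\<close>
  and \<open>b\<close> accounts for the difference.\<close>

lemma deficit_remove:
  assumes "finite V" "i \<in> V" "down_closed \<B>"
  defines "a \<equiv> pmeas (1/2) (V - {i}) \<B>" and "b \<equiv> pmeas (1/2) (V - {i}) (link i \<B>)"
  shows "(1 - p) * deficit (V - {i}) \<B> + p * deficit (V - {i}) (link i \<B>) + (1/2 - p) / 16 * (b * (a - b) / a)
     \<le> deficit V \<B>"
proof -
  have "0 \<le> b" "b \<le> a" "a \<le> 1"
    using assms(1,3) unfolding a_def b_def by (auto intro!: pmeas_nonneg pmeas_link_le pmeas_le_1)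
  from powr_two_point[OF this] show ?thesis
    unfolding deficit_def pmeas_remove[OF assms(1,2), of p] pmeas_half_remove[OF assms(1,2)]
    by (fold a_def b_def) (simp add: algebra_simps)
qed

lemma two_point_gain_nonneg: "0 \<le> b \<Longrightarrow> b \<le> a \<Longrightarrow> 0 \<le> (1/2 - p) / 16 * (b * (a - b) / a)"
  using p by (intro mult_nonneg_nonneg divide_nonneg_nonneg) auto

lemma deficit_nonneg:
  assumes "finite V" "down_closed \<B>"
  shows "0 \<le> deficit V \<B>"
  using assms
proof (induction V arbitrary: \<B> rule: finite_induct)
  case empty
  then show ?case by (simp add: deficit_def pmeas_empty)
next
  case (insert i V)
  have "0 \<le> (1 - p) * deficit V \<B> + p * deficit V (link i \<B>)"
    using insert p by (intro add_nonneg_nonneg mult_nonneg_nonneg insert.IH down_closed_link) auto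
  moreover have "0 \<le> pmeas (1/2) V (link i \<B>)" "pmeas (1/2) V (link i \<B>) \<le> pmeas (1/2) V \<B>"
    using insert by (auto intro!: pmeas_nonneg pmeas_link_le)
  ultimately show ?case
    using deficit_remove[of "insert i V" i \<B>] two_point_gain_nonneg insert by fastforce
qed

lemma two_point_gain_le_deficit:
  assumes "finite V" "i \<in> V" "down_closed \<B>"
  defines "a \<equiv> pmeas (1/2) (V - {i}) \<B>" and "b \<equiv> pmeas (1/2) (V - {i}) (link i \<B>)"
  shows "(1/2 - p) / 16 * (b * (a - b) / a) \<le> deficit V \<B>"
proof -
  have "0 \<le> (1 - p) * deficit (V - {i}) \<B> + p * deficit (V - {i}) (link i \<B>)"
    using assms p by (intro add_nonneg_nonneg mult_nonneg_nonneg deficit_nonneg down_closed_link) auto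
  then show ?thesis using deficit_remove[OF assms(1-3)] by (simp add: a_def b_def)
qed

text \<open>The half without \<open>i\<close> has weight \<open>1 - p\<close>, at least 1/2. The
  resulting factor 2 is matched by the factor \<open>2 ^ r\<close> in the hypotheses of the
  induction over \<open>r\<close>.\<close>

lemma deficit_delete_le:
  assumes "finite V" "i \<in> V" "down_closed \<B>"
  shows "deficit (V - {i}) \<B> \<le> 2 * deficit V \<B>"
proof -
  let ?a = "pmeas (1/2) (V - {i}) \<B>" and ?b = "pmeas (1/2) (V - {i}) (link i \<B>)"
  have "0 \<le> p * deficit (V - {i}) (link i \<B>)"
    using assms p by (intro mult_nonneg_nonneg deficit_nonneg down_closed_link) auto
  moreover have "0 \<le> (1/2 - p) / 16 * (?b * (?a - ?b) / ?a)"
    using assms by (intro two_point_gain_nonneg pmeas_nonneg pmeas_link_le) auto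
  ultimately have "(1 - p) * deficit (V - {i}) \<B> \<le> deficit V \<B>"
    using deficit_remove[OF assms] by linarith
  moreover have "1/2 * deficit (V - {i}) \<B> \<le> (1 - p) * deficit (V - {i}) \<B>"
    using assms p by (intro mult_right_mono deficit_nonneg) auto
  ultimately show ?thesis by simp
qed

end

section \<open>Down-sets with small deficit\<close>

context biased_exponent
begin

text \<open>If \<open>b / a\<close> were strictly between 1/10 and 9/10, the gain would exceed
  \<open>(1/2 - p) * a * 9 / 1600\<close>, while the deficit is at most
  \<open>(1/2 - p) * a * 8 / 1600\<close>.\<close>

lemma link_dichotomy:
  assumes "finite V" "i \<in> V" "down_closed \<B>"
    and "deficit V \<B> \<le> (1/2 - p) / 200 * pmeas (1/2) V \<B>"
  defines "a \<equiv> pmeas (1/2) (V - {i}) \<B>" and "b \<equiv> pmeas (1/2) (V - {i}) (link i \<B>)"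
  shows "b \<le> a / 10 \<or> 9 / 10 * a \<le> b"
proof (rule ccontr)
  assume "\<not> ?thesis"
  then have ab: "a / 10 < b" "b < 9 / 10 * a" by auto
  have a: "0 < a" using ab by linarith
  have "0 < (b - a / 10) * (9 / 10 * a - b)" using ab by (intro mult_pos_pos) auto
  then have "9 / 100 * a < b * (a - b) / a" using a by (simp add: field_simps power2_eq_square)
  then have "(1/2 - p) / 16 * (9 / 100 * a) < (1/2 - p) / 16 * (b * (a - b) / a)"
    using p by (intro mult_strict_left_mono) auto
  also have "\<dots> \<le> deficit V \<B>"
    unfolding a_def b_def by (intro two_point_gain_le_deficit assms(1-3))
  also have "\<dots> \<le> (1/2 - p) / 200 * a"
  proof -
    have "b \<le> a" using assms(1,3) unfolding a_def b_def by (intro pmeas_link_le) auto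
    then have "pmeas (1/2) V \<B> \<le> a"
      unfolding pmeas_half_remove[OF assms(1,2)] by (fold a_def b_def) simp
    then have "(1/2 - p) / 200 * pmeas (1/2) V \<B> \<le> (1/2 - p) / 200 * a"
      using p by (intro mult_left_mono) auto
    then show ?thesis using assms(4) by linarith
  qed
  finally have "(1/2 - p) * a * (9 / 1600) < (1/2 - p) * a * (1 / 200)" by simp
  moreover have "0 < (1/2 - p) * a" using a p by simp
  ultimately show False by linarith
qed

lemma convex_bound_ge:
  fixes x y z v :: real
  assumes "z \<le> x" "z \<le> y" "0 \<le> v" "v \<le> 1"
  shows "z \<le> (1 - v) * x + v * y"
proof -
  have "(1 - v) * z + v * z \<le> (1 - v) * x + v * y"
    using assms by (intro add_mono mult_left_mono) auto
  then show ?thesis by (simp add: algebra_simps)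
qed

text \<open>The bound on the deficit is a Lipschitz function of the measure, with a constant so small
  that the gain in the two-point inequality compensates its variation. Hence it passes to one of the
  two halves of the cube, which supplies the coordinate \<open>i\<close>; the dichotomy then forces
  \<open>i\<close> to work for the whole cube. For \<open>V = {}\<close> the bound is negative.\<close>

theorem exists_small_link:
  assumes "finite V" "down_closed \<B>" "0 < pmeas (1/2) V \<B>"
    and "deficit V \<B> \<le> (1/2 - p) / 200 * min (pmeas (1/2) V \<B>) (7/8 - pmeas (1/2) V \<B>)"
  shows "\<exists>i\<in>V. pmeas (1/2) (V - {i}) (link i \<B>) \<le> pmeas (1/2) (V - {i}) \<B> / 10"
  using assms
proof (induction V arbitrary: \<B> rule: finite_induct)
  case empty
  then have "pmeas (1/2) {} \<B> = 1" by (auto simp: pmeas_empty split: if_splits)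
  then have "deficit {} \<B> \<le> (1/2 - p) / 200 * (- 1/8)" using empty by simp
  moreover have "(1/2 - p) / 200 * (- 1/8) < 0" using p by simp
  moreover have "0 \<le> deficit {} \<B>" using empty by (intro deficit_nonneg) auto
  ultimately show ?case by linarith
next
  case (insert v V)
  define \<Phi> where "\<Phi> = (\<lambda>x. (1/2 - p) / 200 * min x (7/8 - x))"
  define a where "a = pmeas (1/2) V \<B>"
  define b where "b = pmeas (1/2) V (link v \<B>)"
  have Vv: "insert v V - {v} = V" using insert.hyps by auto
  have fin: "finite (insert v V)" using insert.hyps by simp
  define c where "c = pmeas (1/2) (insert v V) \<B>"
  have c: "a + b = 2 * c"
    using pmeas_half_remove[OF fin, of v \<B>] by (simp add: Vv a_def b_def c_def)
  have ba: "b \<le> a" using insert unfolding a_def b_def by (intro pmeas_link_le) auto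
  have dc: "down_closed (link v \<B>)" using insert.prems by (intro down_closed_link)
  have le: "deficit (insert v V) \<B> \<le> (1/2 - p) / 200 * pmeas (1/2) (insert v V) \<B>"
  proof -
    have "(1/2 - p) / 200 * min (pmeas (1/2) (insert v V) \<B>) (7/8 - pmeas (1/2) (insert v V) \<B>)
      \<le> (1/2 - p) / 200 * pmeas (1/2) (insert v V) \<B>"
      using p by (intro mult_left_mono) auto
    then show ?thesis using insert.prems(3) by linarith
  qed
  note dich = link_dichotomy[OF fin _ insert.prems(1) le]
  show ?case
  proof (cases "b \<le> a / 10")
    case True
    then show ?thesis by (intro bexI[of _ v]) (auto simp: Vv a_def b_def)
  next
    case False
    then have b: "9 / 10 * a \<le> b" using dich[of v] by (auto simp: Vv a_def b_def)
    have a0: "0 < a" using insert.prems(2) c ba by (simp flip: c_def)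
    then have b0: "0 < b" using b by linarith
    have "deficit V \<B> \<le> \<Phi> a \<or> deficit V (link v \<B>) \<le> \<Phi> b"
    proof (rule ccontr)
      assume "\<not> ?thesis"
      then have "(1 - p) * \<Phi> a < (1 - p) * deficit V \<B>" "p * \<Phi> b < p * deficit V (link v \<B>)"
        using p by (auto intro!: mult_strict_left_mono)
      moreover have "(1 - p) * deficit V \<B> + p * deficit V (link v \<B>) + (1/2 - p) / 16 * (b * (a - b) / a)
        \<le> \<Phi> c"
        using deficit_remove[OF fin insertI1 insert.prems(1), unfolded Vv, folded a_def b_def]
          insert.prems(3)[folded c_def] unfolding \<Phi>_def by linarith
      ultimately have "(1 - p) * \<Phi> a + p * \<Phi> b + (1/2 - p) / 16 * (b * (a - b) / a) < \<Phi> c"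
        by linarith
      moreover have "(1/2 - p) / 16 * (9 / 10 * (a - b)) \<le> (1/2 - p) / 16 * (b * (a - b) / a)"
      proof -
        have "9 / 10 \<le> b / a" using b a0 by (simp add: field_simps)
        then have "9 / 10 * (a - b) \<le> b / a * (a - b)" using ba by (intro mult_right_mono) auto
        then show ?thesis using p by (intro mult_left_mono) auto
      qed
      \<comment> \<open>\<open>\<Phi>\<close> has Lipschitz constant \<open>(1/2 - p) / 200\<close>,
        and \<open>c\<close> is the midpoint of \<open>a\<close> and \<open>b\<close>, at distance
        \<open>a - c\<close> from both.\<close>
      moreover have "\<Phi> c - (1/2 - p) / 200 * (a - c) \<le> \<Phi> a" "\<Phi> c - (1/2 - p) / 200 * (a - c) \<le> \<Phi> b"
      proof -
        have "min c (7/8 - c) - (a - c) \<le> min a (7/8 - a)" "min c (7/8 - c) - (a - c) \<le> min b (7/8 - b)"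
          using ba c by (auto simp: min_def)
        then have "(1/2 - p) / 200 * (min c (7/8 - c) - (a - c)) \<le> \<Phi> a"
          "(1/2 - p) / 200 * (min c (7/8 - c) - (a - c)) \<le> \<Phi> b"
          unfolding \<Phi>_def using p by (intro mult_left_mono; simp)+
        then show "\<Phi> c - (1/2 - p) / 200 * (a - c) \<le> \<Phi> a" "\<Phi> c - (1/2 - p) / 200 * (a - c) \<le> \<Phi> b"
          unfolding \<Phi>_def right_diff_distrib by auto
      qed
      then have "\<Phi> c - (1/2 - p) / 200 * (a - c) \<le> (1 - p) * \<Phi> a + p * \<Phi> b"
        using p by (intro convex_bound_ge) auto
      \<comment> \<open>Per unit of \<open>(1/2 - p) * (a - c)\<close> the gain is at least 9/80,
        while \<open>\<Phi>\<close> varies by at most 1/200; only \<open>a = c\<close> could balance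
        them, and the inequality is strict.\<close>
      ultimately have "(1/2 - p) / 16 * (9 / 10 * (a - b)) < (1/2 - p) / 200 * (a - c)" by linarith
      moreover have "a - b = 2 * (a - c)" using c by simp
      ultimately have "(1/2 - p) / 16 * (9 / 10 * (2 * (a - c))) < (1/2 - p) / 200 * (a - c)" by (simp only:)
      moreover define y where "y = (1/2 - p) * (a - c)"
      moreover have "(1/2 - p) / 16 * (9 / 10 * (2 * (a - c))) = y * (9 / 80)"
        "(1/2 - p) / 200 * (a - c) = y * (1 / 200)" by (auto simp: y_def)
      ultimately have "y * (9 / 80) < y * (1 / 200)" by (simp only:)
      moreover have "0 \<le> y" using p ba c by (simp add: y_def)
      ultimately show False by linarith
    qed
    then have "\<exists>i\<in>V. pmeas (1/2) (V - {i}) (link i \<B>) \<le> pmeas (1/2) (V - {i}) \<B> / 10 \<or>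
      pmeas (1/2) (V - {i}) (link i (link v \<B>)) \<le> pmeas (1/2) (V - {i}) (link v \<B>) / 10"
      using insert.IH[OF insert.prems(1)] insert.IH[OF dc] a0 b0 unfolding \<Phi>_def a_def b_def by blast
    then obtain i where i: "i \<in> V" and small:
      "pmeas (1/2) (V - {i}) (link i \<B>) \<le> pmeas (1/2) (V - {i}) \<B> / 10 \<or>
       pmeas (1/2) (V - {i}) (link i (link v \<B>)) \<le> pmeas (1/2) (V - {i}) (link v \<B>) / 10" by blast
    define W where "W = V - {i}"
    have W: "finite W" "v \<notin> W" "insert v V - {i} = insert v W" "insert v W - {v} = W"
      using insert.hyps i by (auto simp: W_def)
    \<comment> \<open>Measures of the four quarters of the cube: the first digit records
      \<open>i\<close>, the second \<open>v\<close>.\<close>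
    define b00 b10 b01 b11 where "b00 = pmeas (1/2) W \<B>" and "b10 = pmeas (1/2) W (link i \<B>)"
      and "b01 = pmeas (1/2) W (link v \<B>)" and "b11 = pmeas (1/2) W (link i (link v \<B>))"
    note bs = b00_def b10_def b01_def b11_def
    have a_eq: "2 * a = b00 + b10" and b_eq: "2 * b = b01 + b11"
      unfolding a_def b_def pmeas_half_remove[OF insert.hyps(1) i] bs W_def by simp_all
    have "b10 \<le> b00" unfolding bs using W(1) insert.prems(1) by (intro pmeas_link_le) auto
    moreover have "b11 \<le> b10" unfolding bs link_commute[of i v]
      by (intro pmeas_link_le down_closed_link W insert.prems) auto
    moreover have "0 \<le> b11" unfolding bs by (intro pmeas_nonneg) auto
    ultimately have mono: "b10 \<le> b00" "b11 \<le> b10" "0 \<le> b11" by auto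
    define d e where "d = pmeas (1/2) (insert v V - {i}) \<B>"
      and "e = pmeas (1/2) (insert v V - {i}) (link i \<B>)"
    have de: "2 * d = b00 + b01" "2 * e = b10 + b11"
      using W pmeas_half_remove[of "insert v W" v \<B>] pmeas_half_remove[of "insert v W" v "link i \<B>"]
      by (simp_all add: bs d_def e_def link_commute[of i v])
    \<comment> \<open>Since \<open>v\<close> is almost irrelevant, a coordinate \<open>i\<close>
      that is decisive on one of the two halves cannot be almost irrelevant on the whole
      cube.\<close>
    have "\<not> 9 / 10 * d \<le> e"
      using small[folded W_def, folded bs] mono a_eq b_eq b a0 de by linarith
    moreover have "e \<le> d / 10 \<or> 9 / 10 * d \<le> e"
      unfolding d_def e_def using i by (intro dich) auto
    ultimately show ?thesis using i unfolding d_def e_def by blast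
  qed
qed

text \<open>Deleting a decisive coordinate nearly doubles the measure:
  \<open>2 * \<beta> \<le> (1 + \<xi>) * a\<close>. The hypotheses persist with \<open>r\<close>
  lowered by one, because measure and deficit at most double and the measure does not fall below
  \<open>L\<close>.\<close>

theorem exists_codimension_subcube:
  assumes "finite V" "down_closed \<B>"
    and "L \<le> pmeas (1/2) V \<B>" "2 ^ r * pmeas (1/2) V \<B> \<le> 3/2" "2 ^ r * deficit V \<B> \<le> H"
    and "0 < L" "0 \<le> H" "H \<le> (1/2 - p) / 200 * min L (1/8)"
  shows "\<exists>R\<subseteq>V. card R = r \<and> 2 ^ r * pmeas (1/2) V \<B> \<le> (1 + 18 * H / ((1/2 - p) * L)) ^ r * pmeas (1/2) (V - R) \<B>"
  using assms(1-5)
proof (induction r arbitrary: V)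
  case 0
  then show ?case by (intro exI[of _ "{}"]) auto
next
  case (Suc r)
  define \<xi> where "\<xi> = 18 * H / ((1/2 - p) * L)"
  have \<xi>: "0 \<le> \<xi>" using assms(6,7) p by (simp add: \<xi>_def)
  define \<beta> where "\<beta> = pmeas (1/2) V \<B>"
  have \<beta>: "L \<le> \<beta>" "0 < \<beta>" using Suc.prems assms(6) by (auto simp: \<beta>_def)
  \<comment> \<open>As a coordinate is still to be removed, \<open>\<beta>\<close> is at most 3/4,
    so that \<open>7/8 - \<beta>\<close> is at least 1/8.\<close>
  have "1 * \<beta> \<le> 2 ^ r * \<beta>" using \<beta> by (intro mult_right_mono) auto
  then have \<beta>34: "\<beta> \<le> 3/4" using Suc.prems(4) by (simp add: \<beta>_def)
  have dn: "0 \<le> deficit V \<B>" using Suc.prems by (intro deficit_nonneg)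
  then have "1 * deficit V \<B> \<le> 2 ^ Suc r * deficit V \<B>" by (intro mult_right_mono one_le_power) auto
  then have dH: "deficit V \<B> \<le> H" using Suc.prems(5) by simp
  have "(1/2 - p) / 200 * min L (1/8) \<le> (1/2 - p) / 200 * min \<beta> (7/8 - \<beta>)"
    using p \<beta> \<beta>34 by (intro mult_left_mono) (auto simp: min_def)
  with dH assms(8) have "deficit V \<B> \<le> (1/2 - p) / 200 * min \<beta> (7/8 - \<beta>)" by linarith
  with exists_small_link[OF Suc.prems(1,2)] \<beta> obtain i where i: "i \<in> V"
    "pmeas (1/2) (V - {i}) (link i \<B>) \<le> pmeas (1/2) (V - {i}) \<B> / 10" unfolding \<beta>_def by blast
  define a where "a = pmeas (1/2) (V - {i}) \<B>"
  define b where "b = pmeas (1/2) (V - {i}) (link i \<B>)"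
  have half: "\<beta> = (a + b) / 2" unfolding \<beta>_def a_def b_def by (rule pmeas_half_remove[OF Suc.prems(1) i(1)])
  have b: "0 \<le> b" "b \<le> a / 10" using i(2) by (auto simp: a_def b_def intro!: pmeas_nonneg)
  have a: "\<beta> \<le> a" "0 < a" "a \<le> 2 * \<beta>" using b half \<beta> by auto
  \<comment> \<open>With \<open>a - b\<close> at least \<open>9/10 * a\<close> the gain is linear in
    \<open>b\<close>; the factor 160/9 is rounded up to 18.\<close>
  have bxi: "b \<le> \<xi> * a"
  proof -
    have "(1/2 - p) / 16 * (b * (9/10)) \<le> (1/2 - p) / 16 * (b * (a - b) / a)"
    proof -
      have "9/10 \<le> (a - b) / a" using a b by (simp add: field_simps)
      then have "b * (9/10) \<le> b * ((a - b) / a)" using b by (intro mult_left_mono) auto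
      then show ?thesis using p by (intro mult_left_mono) auto
    qed
    also have "\<dots> \<le> H"
      using two_point_gain_le_deficit[OF Suc.prems(1) i(1) Suc.prems(2)] dH by (simp add: a_def b_def)
    finally have "b * (1/2 - p) \<le> 18 * H" using assms(7) by (simp add: field_simps)
    then have "b \<le> 18 * H / (1/2 - p)" using p by (subst pos_le_divide_eq) auto
    also have "\<dots> = \<xi> * L" using assms(6) by (simp add: \<xi>_def)
    finally have "b \<le> \<xi> * L" .
    also have "\<xi> * L \<le> \<xi> * a" using \<xi> a \<beta> by (intro mult_left_mono) auto
    finally show ?thesis .
  qed
  have "\<exists>R\<subseteq>V - {i}. card R = r \<and> 2 ^ r * a \<le> (1 + \<xi>) ^ r * pmeas (1/2) (V - {i} - R) \<B>"
    unfolding a_def \<xi>_def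
  proof (rule Suc.IH)
    show "2 ^ r * pmeas (1/2) (V - {i}) \<B> \<le> 3/2"
    proof -
      have "2 ^ r * a \<le> 2 ^ r * (2 * \<beta>)" using a by (intro mult_left_mono) auto
      then have "2 ^ r * a \<le> 2 ^ Suc r * \<beta>" by simp
      then show ?thesis using Suc.prems(4) unfolding a_def \<beta>_def by linarith
    qed
    have "2 ^ r * deficit (V - {i}) \<B> \<le> 2 ^ r * (2 * deficit V \<B>)"
      by (intro mult_left_mono deficit_delete_le Suc.prems i) auto
    then have "2 ^ r * deficit (V - {i}) \<B> \<le> 2 ^ Suc r * deficit V \<B>" by simp
    then show "2 ^ r * deficit (V - {i}) \<B> \<le> H" using Suc.prems(5) by linarith
  qed (use Suc.prems a \<beta> in \<open>auto simp: a_def\<close>)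
  then obtain R where R: "R \<subseteq> V - {i}" "card R = r"
    "2 ^ r * a \<le> (1 + \<xi>) ^ r * pmeas (1/2) (V - {i} - R) \<B>" by blast
  have VR: "V - {i} - R = V - insert i R" by auto
  have "2 * \<beta> \<le> (1 + \<xi>) * a" using bxi half by (simp add: algebra_simps)
  then have "2 ^ r * (2 * \<beta>) \<le> 2 ^ r * ((1 + \<xi>) * a)" by (intro mult_left_mono) auto
  then have "2 ^ Suc r * \<beta> \<le> 2 ^ r * ((1 + \<xi>) * a)" by simp
  also have "\<dots> = (1 + \<xi>) * (2 ^ r * a)" by simp
  also have "\<dots> \<le> (1 + \<xi>) * ((1 + \<xi>) ^ r * pmeas (1/2) (V - {i} - R) \<B>)"
    using \<xi> R by (intro mult_left_mono) auto
  finally have "2 ^ Suc r * \<beta> \<le> (1 + \<xi>) ^ Suc r * pmeas (1/2) (V - insert i R) \<B>"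
    unfolding VR by (simp add: mult.assoc)
  moreover have "card (insert i R) = Suc r"
    using R i finite_subset[OF R(1)] Suc.prems(1) by (subst card_insert_disjoint) auto
  ultimately show ?case using R i unfolding \<beta>_def \<xi>_def by (intro exI[of _ "insert i R"]) auto
qed

section \<open>Down-sets of measure close to \<open>(1/2) ^ r\<close>\<close>

lemma one_minus_p_power: "(1 - p) ^ r = ((1/2) ^ r) powr \<theta>"
proof -
  have "((1/2::real) ^ r) powr \<theta> = ((1/2) powr \<theta>) ^ r"
    by (induction r) (simp, simp only: power_Suc, subst powr_mult, auto)
  then show ?thesis by (simp only: half_powr_exponent)
qed

lemma deficit_le:
  assumes "(1/2) ^ r \<le> pmeas (1/2) V \<B>" "pmeas p V \<B> \<le> (1 - p) ^ r + \<epsilon>"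
  shows "deficit V \<B> \<le> \<epsilon>"
proof -
  have "(1 - p) ^ r \<le> pmeas (1/2) V \<B> powr \<theta>"
    unfolding one_minus_p_power using assms(1) exponent_ge_half by (intro powr_mono2) auto
  then show ?thesis using assms(2) by (simp add: deficit_def)
qed

text \<open>The comparison of measures also bounds uniform measure from above. Were it larger than
  claimed, scaling by \<open>(2 ^ r) powr \<theta>\<close> would give
  \<open>(3/2) powr \<theta> \<le> 1 + 2 ^ r * \<epsilon> \<le> 6/5\<close>, but
  \<open>\<theta> \<ge> 1/2\<close> and \<open>sqrt (3/2) > 6/5\<close>.\<close>

lemma half_measure_le:
  assumes "finite V" "down_closed \<B>" "pmeas p V \<B> \<le> (1 - p) ^ r + \<epsilon>" "0 \<le> \<epsilon>" "2 ^ r * \<epsilon> \<le> 1/5"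
  shows "2 ^ r * pmeas (1/2) V \<B> \<le> 3/2"
proof (rule ccontr)
  define \<beta> where "\<beta> = pmeas (1/2) V \<B>"
  assume "\<not> 2 ^ r * pmeas (1/2) V \<B> \<le> 3/2"
  then have gt: "3/2 \<le> 2 ^ r * \<beta>" by (simp add: \<beta>_def)
  have \<beta>: "0 \<le> \<beta>" unfolding \<beta>_def by (intro pmeas_nonneg) auto
  have "6/5 < sqrt (3/2)" by (intro real_less_rsqrt) (simp add: power2_eq_square)
  also have "\<dots> = (3/2) powr (1/2)" by (simp add: powr_half_sqrt)
  also have "\<dots> \<le> (3/2) powr \<theta>" using exponent_ge_half by (intro powr_mono) auto
  also have "\<dots> \<le> (2 ^ r * \<beta>) powr \<theta>" using gt exponent_ge_half by (intro powr_mono2) auto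
  also have "\<dots> = (2 ^ r) powr \<theta> * \<beta> powr \<theta>" using \<beta> by (simp add: powr_mult)
  also have "\<dots> \<le> (2 ^ r) powr \<theta> * (((1/2) ^ r) powr \<theta> + \<epsilon>)"
    using deficit_nonneg[OF assms(1,2)] assms(3) unfolding one_minus_p_power
    by (intro mult_left_mono) (auto simp: deficit_def \<beta>_def)
  also have "\<dots> = 1 + (2 ^ r) powr \<theta> * \<epsilon>"
  proof -
    have "(2 ^ r) powr \<theta> * ((1/2) ^ r) powr \<theta> = (2 ^ r * (1/2 :: real) ^ r) powr \<theta>"
      by (rule powr_mult[symmetric])
    also have "2 ^ r * (1/2 :: real) ^ r = 1" by (simp flip: power_mult_distrib)
    finally show ?thesis by (simp add: algebra_simps)
  qed
  also have "\<dots> \<le> 1 + 2 ^ r * \<epsilon>"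
  proof -
    have "(2 ^ r :: real) powr \<theta> \<le> (2 ^ r) powr 1"
      using exponent_le p by (intro powr_mono) auto
    then show ?thesis using assms(4) by (simp add: mult_right_mono)
  qed
  also have "\<dots> \<le> 6/5" using assms(5) by simp
  finally show False by simp
qed

end

section \<open>Levels and tails\<close>

definition level :: "'a set \<Rightarrow> nat \<Rightarrow> 'a set set \<Rightarrow> 'a set set" where
  "level V l \<B> = {S \<in> \<B>. S \<subseteq> V \<and> card S = l}"

lemma finite_level: "finite V \<Longrightarrow> finite (level V l \<B>)"
  by (rule finite_subset[of _ "Pow V"]) (auto simp: level_def)

lemma card_level_le: "finite V \<Longrightarrow> card (level V l \<B>) \<le> card V choose l"
proof -
  assume V: "finite V"
  have "level V l \<B> \<subseteq> nsets V l" using V by (auto simp: level_def nsets_def intro: finite_subset)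
  then show ?thesis using V card_mono[OF finite_imp_finite_nsets] by (metis card_nsets)
qed

lemma pmeas_eq_sum_levels:
  assumes "finite V"
  shows "pmeas p V \<B> = (\<Sum>l\<le>card V. real (card (level V l \<B>)) * (p ^ l * (1 - p) ^ (card V - l)))"
proof -
  let ?A = "{S \<in> \<B>. S \<subseteq> V}" and ?w = "\<lambda>l. p ^ l * (1 - p) ^ (card V - l)"
  have "pmeas p V \<B> = (\<Sum>l\<le>card V. \<Sum>S\<in>{S \<in> ?A. card S = l}. ?w (card S))"
    unfolding pmeas_def using assms by (intro sum.group[symmetric]) (auto intro: card_mono)
  also have "\<dots> = (\<Sum>l\<le>card V. real (card (level V l \<B>)) * ?w l)"
  proof (rule sum.cong[OF refl])
    fix l
    have "{S \<in> ?A. card S = l} = level V l \<B>" by (auto simp: level_def)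
    then have "(\<Sum>S\<in>{S \<in> ?A. card S = l}. ?w (card S)) = (\<Sum>S\<in>level V l \<B>. ?w l)"
      by (intro sum.cong) (auto simp: level_def)
    then show "(\<Sum>S\<in>{S \<in> ?A. card S = l}. ?w (card S)) = real (card (level V l \<B>)) * ?w l" by simp
  qed
  finally show ?thesis .
qed

text \<open>In a down-set the shadow of one level lies in the level below, so Kruskal--Katona
  applies in contrapositive form, one level at a time. From \<open>k \<ge> 2\<close> on, the upper
  level has size at least 3.\<close>

lemma card_level_le_cascade:
  assumes "finite V" "down_closed \<B>" "2 \<le> k" "k \<le> l"
    and "card (level V k \<B>) \<le> (a choose k) + (b choose (k - 1))"
  shows "card (level V l \<B>) \<le> (a choose l) + (b choose (l - 1))"
  using assms(4)
proof (induction l rule: dec_induct)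
  case base
  then show ?case using assms(5) .
next
  case (step l)
  show ?case
  proof (rule ccontr)
    assume "\<not> ?thesis"
    then have "(a choose Suc l) + (b choose (Suc l - 1)) < card (level V (Suc l) \<B>)" by simp
    moreover have "level V (Suc l) \<B> \<subseteq> nsets V (Suc l)"
      using assms(1) by (auto simp: level_def nsets_def intro: finite_subset)
    ultimately have "(a choose (Suc l - 1)) + (b choose (Suc l - 2)) < card (shadow (level V (Suc l) \<B>))"
      using assms(1,3) step.hyps by (intro kruskal_katona_two_terms[of V]) auto
    also have "\<dots> \<le> card (level V l \<B>)"
    proof (intro card_mono finite_level assms(1) subsetI)
      fix T assume "T \<in> shadow (level V (Suc l) \<B>)"
      then obtain S x where "S \<in> level V (Suc l) \<B>" "x \<in> S" "T = S - {x}" by (rule shadowE)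
      then show "T \<in> level V l \<B>" using assms(2) by (auto simp: level_def down_closed_def)
    qed
    finally show False using step.IH by (simp add: numeral_2_eq_2)
  qed
qed

section \<open>Lower tails of the binomial distribution\<close>

lemma exp_minus_le_quadratic:
  fixes x :: real assumes "0 \<le> x" shows "exp (- x) \<le> 1 - x + x\<^sup>2 / 2"
proof -
  have pos: "0 < 1 + x + x\<^sup>2 / 2" using assms by (simp add: add_pos_nonneg)
  have "1 + x + x\<^sup>2 / 2 \<le> exp x" using assms by (rule exp_lower_Taylor_quadratic)
  then have "exp (- x) \<le> 1 / (1 + x + x\<^sup>2 / 2)" using pos by (simp add: exp_minus field_simps)
  also have "\<dots> \<le> 1 - x + x\<^sup>2 / 2"
  proof -
    have "(1 - x + x\<^sup>2 / 2) * (1 + x + x\<^sup>2 / 2) = 1 + (x\<^sup>2)\<^sup>2 / 4"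
      by (simp add: algebra_simps power2_eq_square)
    then show ?thesis using pos by (simp add: divide_le_eq)
  qed
  finally show ?thesis .
qed

text \<open>The Chernoff argument: each term with \<open>l < k\<close> is weighted by
  \<open>exp (x * (k - l))\<close>, which is at least 1; then the sum is completed and evaluated by
  the binomial theorem.\<close>

lemma binomial_lower_tail_le:
  fixes p x :: real
  assumes "0 \<le> p" "p \<le> 1" "0 \<le> x"
  shows "(\<Sum>l<k. real (n choose l) * (p ^ l * (1 - p) ^ (n - l))) \<le> exp (x * real k - real n * p * (x - x\<^sup>2 / 2))"
proof -
  let ?t = "\<lambda>l. real (n choose l) * (p ^ l * (1 - p) ^ (n - l))"
  have "(\<Sum>l<k. ?t l) = (\<Sum>l\<in>{..<k} \<inter> {..n}. ?t l)"
    by (intro sum.mono_neutral_right) (auto simp: binomial_eq_0)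
  also have "\<dots> \<le> (\<Sum>l\<in>{..<k} \<inter> {..n}. exp (x * k) * (real (n choose l) * (p * exp (- x)) ^ l * (1 - p) ^ (n - l)))"
  proof (rule sum_mono)
    fix l assume "l \<in> {..<k} \<inter> {..n}"
    then have "1 \<le> exp (x * (real k - real l))" using assms by simp
    also have "\<dots> = exp (x * k) * exp (- x) ^ l"
      by (simp add: algebra_simps flip: exp_of_nat_mult exp_add)
    finally have "?t l * 1 \<le> ?t l * (exp (x * k) * exp (- x) ^ l)"
      using assms by (intro mult_left_mono) auto
    then show "?t l \<le> exp (x * k) * (real (n choose l) * (p * exp (- x)) ^ l * (1 - p) ^ (n - l))"
      by (simp add: power_mult_distrib algebra_simps)
  qed
  also have "\<dots> \<le> (\<Sum>l\<le>n. exp (x * k) * (real (n choose l) * (p * exp (- x)) ^ l * (1 - p) ^ (n - l)))"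
    using assms by (intro sum_mono2) auto
  also have "\<dots> = exp (x * k) * (p * exp (- x) + (1 - p)) ^ n"
    by (simp add: binomial_ring sum_distrib_left)
  also have "\<dots> \<le> exp (x * k) * exp (- p * (x - x\<^sup>2 / 2)) ^ n"
  proof (intro mult_left_mono power_mono)
    have "p * exp (- x) \<le> p * (1 - x + x\<^sup>2 / 2)"
      using assms by (intro mult_left_mono exp_minus_le_quadratic)
    then have "p * exp (- x) + (1 - p) \<le> 1 + (- p * (x - x\<^sup>2 / 2))" by (simp add: algebra_simps)
    also have "\<dots> \<le> exp (- p * (x - x\<^sup>2 / 2))" by (rule exp_ge_add_one_self)
    finally show "p * exp (- x) + (1 - p) \<le> exp (- p * (x - x\<^sup>2 / 2))" .
  qed (use assms in auto)
  also have "\<dots> = exp (x * real k - real n * p * (x - x\<^sup>2 / 2))"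
    by (simp add: algebra_simps flip: exp_of_nat_mult exp_add)
  finally show ?thesis .
qed

text \<open>The left side is the biased measure of the sets avoiding \<open>n - m\<close> given
  points, summed by levels.\<close>

lemma sum_choose_subcube:
  fixes p :: real
  assumes "m \<le> n"
  shows "(\<Sum>l\<le>n. real (m choose l) * (p ^ l * (1 - p) ^ (n - l))) = (1 - p) ^ (n - m)"
proof -
  have "(\<Sum>l\<le>n. real (m choose l) * (p ^ l * (1 - p) ^ (n - l)))
      = (\<Sum>l\<le>m. real (m choose l) * (p ^ l * (1 - p) ^ (n - l)))"
    using assms by (intro sum.mono_neutral_right) (auto simp: binomial_eq_0)
  also have "\<dots> = (\<Sum>l\<le>m. (1 - p) ^ (n - m) * (real (m choose l) * p ^ l * (1 - p) ^ (m - l)))"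
  proof (rule sum.cong[OF refl])
    fix l assume "l \<in> {..m}"
    then have "n - l = (n - m) + (m - l)" using assms by auto
    then show "real (m choose l) * (p ^ l * (1 - p) ^ (n - l)) = (1 - p) ^ (n - m) * (real (m choose l) * p ^ l * (1 - p) ^ (m - l))"
      by (simp add: power_add)
  qed
  also have "\<dots> = (1 - p) ^ (n - m) * (p + (1 - p)) ^ m"
    by (simp only: binomial_ring sum_distrib_left)
  finally show ?thesis by simp
qed

text \<open>Levels from \<open>k\<close> on are bounded by the cascade, whose two terms are level
  sizes of subcubes and so sum to powers of \<open>1 - p\<close>; the levels below \<open>k\<close>
  are bounded trivially.\<close>

lemma pmeas_le_of_level_le:
  fixes p :: real
  assumes "finite V" "card V = n" "down_closed \<B>" "2 \<le> k" "0 \<le> p" "p \<le> 1/2" "r + t \<le> n" "1 \<le> t"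
    and "card (level V k \<B>) \<le> ((n - r) choose k) + ((n - r - t) choose (k - 1))"
  shows "pmeas p V \<B> \<le> (1 - p) ^ r + (1 - p) ^ t + (\<Sum>l<k. real (n choose l) * (p ^ l * (1 - p) ^ (n - l)))"
proof -
  let ?w = "\<lambda>l. p ^ l * (1 - p) ^ (n - l)"
  \<comment> \<open>The case \<open>l = 0\<close> is set to 0 because the truncated
    \<open>l - 1\<close> would contribute 1.\<close>
  let ?c = "\<lambda>l. if l = 0 then 0 else (n - r - t) choose (l - 1)"
  have "pmeas p V \<B> = (\<Sum>l\<le>n. real (card (level V l \<B>)) * ?w l)"
    using pmeas_eq_sum_levels[OF assms(1)] assms(2) by simp
  also have "\<dots> \<le> (\<Sum>l\<le>n. real ((n - r) choose l) * ?w l + real (?c l) * ?w l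
      + (if l < k then real (n choose l) * ?w l else 0))"
  proof (rule sum_mono)
    fix l assume "l \<in> {..n}"
    have w: "0 \<le> ?w l" using assms by simp
    show "real (card (level V l \<B>)) * ?w l \<le> real ((n - r) choose l) * ?w l + real (?c l) * ?w l
      + (if l < k then real (n choose l) * ?w l else 0)"
    proof (cases "l < k")
      case True
      have "real (card (level V l \<B>)) * ?w l \<le> real (n choose l) * ?w l"
        using card_level_le[OF assms(1), of l \<B>] assms(2) w by (intro mult_right_mono) auto
      moreover have "0 \<le> real ((n - r) choose l) * ?w l" "0 \<le> real (?c l) * ?w l" using w by auto
      ultimately show ?thesis using True by simp
    next
      case False
      then have "card (level V l \<B>) \<le> ((n - r) choose l) + ?c l"
        using card_level_le_cascade[OF assms(1,3,4) _ assms(9), of l] assms(4) by simp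
      then have "real (card (level V l \<B>)) * ?w l \<le> real (((n - r) choose l) + ?c l) * ?w l"
        using w by (intro mult_right_mono) (auto simp only: of_nat_le_iff)
      then show ?thesis using False by (simp add: algebra_simps)
    qed
  qed
  also have "\<dots> = (\<Sum>l\<le>n. real ((n - r) choose l) * ?w l) + (\<Sum>l\<le>n. real (?c l) * ?w l)
      + (\<Sum>l\<le>n. if l < k then real (n choose l) * ?w l else 0)"
    by (simp add: sum.distrib)
  also have "(\<Sum>l\<le>n. real ((n - r) choose l) * ?w l) = (1 - p) ^ r"
    using sum_choose_subcube[of "n - r" n p] assms by simp
  also have "(\<Sum>l\<le>n. real (?c l) * ?w l) \<le> (1 - p) ^ t"
  proof -
    \<comment> \<open>Shifting the index takes out one factor \<open>p\<close> and leaves a subcube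
      sum in dimension \<open>n - 1\<close> with exponent \<open>r + t - 1\<close>; replacing
      \<open>p\<close> by the larger \<open>1 - p\<close> restores the missing power.\<close>
    obtain n' where n': "n = Suc n'" using assms by (cases n) auto
    have "(\<Sum>l\<le>n. real (?c l) * ?w l) = (\<Sum>l\<le>n'. real ((n - r - t) choose l) * (p ^ Suc l * (1 - p) ^ (n' - l)))"
      unfolding n' by (subst sum.atMost_Suc_shift) simp
    also have "\<dots> = p * (\<Sum>l\<le>n'. real ((n - r - t) choose l) * (p ^ l * (1 - p) ^ (n' - l)))"
      by (simp add: sum_distrib_left algebra_simps)
    also have "\<dots> = p * (1 - p) ^ (n' - (n - r - t))"
      using assms n' by (subst sum_choose_subcube) auto
    also have "\<dots> \<le> (1 - p) * (1 - p) ^ (n' - (n - r - t))"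
      using assms by (intro mult_right_mono) auto
    also have "\<dots> = (1 - p) ^ Suc (n' - (n - r - t))" by simp
    also have "\<dots> \<le> (1 - p) ^ t" using assms n' by (intro power_decreasing) auto
    finally show ?thesis .
  qed
  also have "(\<Sum>l\<le>n. if l < k then real (n choose l) * ?w l else 0) \<le> (\<Sum>l<k. real (n choose l) * ?w l)"
  proof -
    have "(\<Sum>l\<le>n. if l < k then real (n choose l) * ?w l else 0) = (\<Sum>l\<in>{..n} \<inter> {l. l < k}. real (n choose l) * ?w l)"
      by (simp add: sum.If_cases)
    also have "\<dots> \<le> (\<Sum>l<k. real (n choose l) * ?w l)"
      using assms by (intro sum_mono2) auto
    finally show ?thesis .
  qed
  finally show ?thesis by (simp add: add_mono)
qed

section \<open>Local LYM by double counting\<close>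

lemma card_supersets_of_size:
  assumes "finite V" "S \<subseteq> V" "card S \<le> l"
  shows "card {T. T \<subseteq> V \<and> card T = l \<and> S \<subseteq> T} = (card V - card S) choose (l - card S)"
proof -
  have fS: "finite S" using assms finite_subset by blast
  have "bij_betw (\<lambda>T. T \<union> S) (nsets (V - S) (l - card S)) {T. T \<subseteq> V \<and> card T = l \<and> S \<subseteq> T}"
  proof (rule bij_betw_byWitness[where f' = "\<lambda>T. T - S"])
    show "(\<lambda>T. T \<union> S) ` nsets (V - S) (l - card S) \<subseteq> {T. T \<subseteq> V \<and> card T = l \<and> S \<subseteq> T}"
    proof (rule image_subsetI)
      fix T assume T: "T \<in> nsets (V - S) (l - card S)"
      then have "card (T \<union> S) = card T + card S" using fS by (intro card_Un_disjoint) (auto simp: nsets_def)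
      then show "T \<union> S \<in> {T. T \<subseteq> V \<and> card T = l \<and> S \<subseteq> T}" using T assms by (auto simp: nsets_def)
    qed
    show "(\<lambda>T. T - S) ` {T. T \<subseteq> V \<and> card T = l \<and> S \<subseteq> T} \<subseteq> nsets (V - S) (l - card S)"
      using assms fS by (auto simp: nsets_def card_Diff_subset intro: finite_subset)
  qed (auto simp: nsets_def)
  from bij_betw_same_card[OF this]
  have "card {T. T \<subseteq> V \<and> card T = l \<and> S \<subseteq> T} = card (V - S) choose (l - card S)"
    by (simp add: card_nsets)
  then show ?thesis using assms fS by (simp add: card_Diff_subset)
qed

text \<open>Counting pairs \<open>S \<subseteq> T\<close>: each \<open>S\<close> has the full number
  of supersets, each \<open>T\<close> has at most \<open>l choose k\<close> subsets. Densities are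
  compared without division.\<close>

lemma density_le_level_up:
  assumes "finite V" "\<G> \<subseteq> nsets V k" "k \<le> l" "l \<le> card V"
  shows "card \<G> * (card V choose l) \<le> (card V choose k) * card (level V l {T. \<exists>S\<in>\<G>. S \<subseteq> T})"
proof -
  let ?U = "level V l {T. \<exists>S\<in>\<G>. S \<subseteq> T}"
  have finG: "finite \<G>" using assms finite_imp_finite_nsets finite_subset by metis
  have finU: "finite ?U" by (rule finite_level[OF assms(1)])
  have "card \<G> * ((card V - k) choose (l - k)) = (\<Sum>S\<in>\<G>. card {T \<in> ?U. S \<subseteq> T})"
  proof -
    have "card {T \<in> ?U. S \<subseteq> T} = (card V - k) choose (l - k)" if "S \<in> \<G>" for S
    proof -
      have S: "S \<subseteq> V" "card S = k" using that assms(2) by (auto simp: nsets_def)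
      have "{T \<in> ?U. S \<subseteq> T} = {T. T \<subseteq> V \<and> card T = l \<and> S \<subseteq> T}" using that by (auto simp: level_def)
      then show ?thesis using card_supersets_of_size[OF assms(1) S(1), of l] S assms(3) by simp
    qed
    then show ?thesis by simp
  qed
  also have "\<dots> = (\<Sum>S\<in>\<G>. \<Sum>T\<in>{T \<in> ?U. S \<subseteq> T}. 1)" by simp
  also have "\<dots> = (\<Sum>T\<in>?U. \<Sum>S\<in>{S \<in> \<G>. S \<subseteq> T}. 1)"
    by (rule sum.swap_restrict[OF finG finU])
  also have "\<dots> \<le> (\<Sum>T\<in>?U. l choose k)"
  proof (rule sum_mono)
    fix T assume T: "T \<in> ?U"
    then have fT: "finite T" "card T = l" using assms(1) by (auto simp: level_def intro: finite_subset)
    have "card {S \<in> \<G>. S \<subseteq> T} \<le> card (nsets T k)"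
      using assms(2) fT by (intro card_mono finite_imp_finite_nsets) (auto simp: nsets_def)
    then show "(\<Sum>S\<in>{S \<in> \<G>. S \<subseteq> T}. 1) \<le> l choose k" using fT by (simp add: card_nsets)
  qed
  finally have *: "card \<G> * ((card V - k) choose (l - k)) \<le> card ?U * (l choose k)" by simp
  have "(l choose k) * (card \<G> * (card V choose l)) = card \<G> * ((card V choose l) * (l choose k))" by simp
  also have "(card V choose l) * (l choose k) = (card V choose k) * ((card V - k) choose (l - k))"
    using assms by (intro choose_mult) auto
  also have "card \<G> * ((card V choose k) * ((card V - k) choose (l - k)))
      = (card V choose k) * (card \<G> * ((card V - k) choose (l - k)))" by simp
  also have "\<dots> \<le> (card V choose k) * (card ?U * (l choose k))" using * by (intro mult_left_mono) auto
  finally have "(l choose k) * (card \<G> * (card V choose l)) \<le> (l choose k) * ((card V choose k) * card ?U)"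
    by (simp add: algebra_simps)
  then show ?thesis using assms(3) by simp
qed

text \<open>The density of \<open>\<G>\<close> bounds the density of its up-closure on every level
  from \<open>k\<close> on. Averaging with binomial weights loses only the mass below
  \<open>k\<close>.\<close>

lemma density_le_pmeas_up:
  fixes p :: real
  assumes "finite V" "\<G> \<subseteq> nsets V k" "0 \<le> p" "p \<le> 1"
  shows "real (card \<G>) * (1 - (\<Sum>l<k. real (card V choose l) * (p ^ l * (1 - p) ^ (card V - l))))
    \<le> real (card V choose k) * pmeas p V {T. \<exists>S\<in>\<G>. S \<subseteq> T}"
proof -
  let ?n = "card V" and ?U = "\<lambda>l. level V l {T. \<exists>S\<in>\<G>. S \<subseteq> T}"
  let ?w = "\<lambda>l. p ^ l * (1 - p) ^ (?n - l)"
  have w: "0 \<le> ?w l" for l using assms by simp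
  have "1 = (\<Sum>l\<le>?n. real (?n choose l) * ?w l)" using sum_choose_subcube[of ?n ?n p] by simp
  also have "\<dots> \<le> (\<Sum>l\<in>{..<k} \<union> {k..?n}. real (?n choose l) * ?w l)"
    using assms(3,4) by (intro sum_mono2) auto
  also have "\<dots> = (\<Sum>l<k. real (?n choose l) * ?w l) + (\<Sum>l=k..?n. real (?n choose l) * ?w l)"
    by (intro sum.union_disjoint) auto
  finally have "real (card \<G>) * (1 - (\<Sum>l<k. real (?n choose l) * ?w l)) \<le> real (card \<G>) * (\<Sum>l=k..?n. real (?n choose l) * ?w l)"
    by (intro mult_left_mono) auto
  also have "\<dots> = (\<Sum>l=k..?n. real (card \<G> * (?n choose l)) * ?w l)" by (simp add: sum_distrib_left algebra_simps)
  also have "\<dots> \<le> (\<Sum>l=k..?n. real ((?n choose k) * card (?U l)) * ?w l)"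
    by (intro sum_mono mult_right_mono w of_nat_mono density_le_level_up assms) auto
  also have "\<dots> = real (?n choose k) * (\<Sum>l=k..?n. real (card (?U l)) * ?w l)"
    by (simp add: sum_distrib_left algebra_simps)
  also have "\<dots> \<le> real (?n choose k) * (\<Sum>l\<le>?n. real (card (?U l)) * ?w l)"
    using assms(3,4) by (intro mult_left_mono sum_mono2) auto
  finally show ?thesis unfolding pmeas_eq_sum_levels[OF assms(1)] .
qed

lemma pmeas_Compl:
  assumes "finite V"
  shows "pmeas p V (- \<B>) = 1 - pmeas p V \<B>"
proof -
  have "pmeas p V UNIV = pmeas p V \<B> + pmeas p V (- \<B>)"
    unfolding pmeas_def using assms by (subst sum.union_disjoint[symmetric]) (auto intro!: sum.cong)
  then show ?thesis using pmeas_UNIV[OF assms, of p] by simp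
qed

section \<open>The removal set\<close>

text \<open>The bias is \<open>p = 1/2 - \<tau>\<close>, and \<open>E\<close> bounds each error term
  separately: the second cascade term and the lower tail at bias \<open>p\<close>, which together
  give \<open>\<epsilon> = 2 * E\<close>, and the lower tail at 1/2 used for the return to level
  \<open>k\<close>.\<close>

lemma exists_removal_set:
  fixes \<tau> E :: real
  assumes V: "finite V" "card V = n" and F: "\<F> \<subseteq> nsets V k" "2 \<le> k" and rt: "r + t \<le> n" "1 \<le> t"
    and \<tau>: "0 < \<tau>" "\<tau> \<le> 1/8" and E: "0 < E" "(5/8) ^ t \<le> E"
    and tail: "(\<Sum>l<k. real (n choose l) * ((1/2 - \<tau>) ^ l * (1 - (1/2 - \<tau>)) ^ (n - l))) \<le> E"
    and tail': "(\<Sum>l<k. real ((n - r) choose l) * ((1/2) ^ l * (1 - 1/2) ^ (n - r - l))) \<le> E"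
    and small: "4 ^ r * (2 * E) * 1600 \<le> \<tau>"
    and meas: "pmeas (1/2) V {T. \<exists>S\<in>\<F>. S \<subseteq> T} \<le> 1 - (1/2) ^ r"
    and size: "real (card \<F>) \<ge> real (n choose k) - real ((n - r) choose k) - real ((n - r - t) choose (k - 1))"
  shows "\<exists>R\<in>nsets V r. real (card {S \<in> \<F>. S \<inter> R = {}})
    \<le> 2 ^ r * (72 * 4 ^ r * E / \<tau>) * real ((n - r) choose k)"
proof -
  define \<B> where "\<B> = - {T. \<exists>S\<in>\<F>. S \<subseteq> T}"
  define p where "p = 1/2 - \<tau>"
  define \<epsilon> where "\<epsilon> = 2 * E"
  define \<xi> where "\<xi> = 18 * (2 ^ r * \<epsilon>) / (\<tau> * (1/2) ^ r)"
  interpret biased_exponent p "log 2 (1 / (1 - p))"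
    using \<tau> by unfold_locales (auto simp: p_def)
  have p\<tau>: "1/2 - p = \<tau>" by (simp add: p_def)
  have dc: "down_closed \<B>" unfolding down_closed_def \<B>_def by blast
  have \<beta>: "(1/2) ^ r \<le> pmeas (1/2) V \<B>" using meas pmeas_Compl[OF V(1)] by (simp add: \<B>_def)
  have finN: "finite (nsets V k)" using V(1) by (rule finite_imp_finite_nsets)
  \<comment> \<open>Sets of equal size contain each other only if they coincide, so on level
    \<open>k\<close> nothing but \<open>\<F>\<close> itself is missing from
    \<open>\<B>\<close>.\<close>
  have "level V k \<B> = nsets V k - \<F>"
  proof (rule antisym; rule subsetI)
    fix S assume "S \<in> level V k \<B>"
    then show "S \<in> nsets V k - \<F>" using V(1) by (auto simp: level_def \<B>_def nsets_def intro: finite_subset)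
  next
    fix S assume S: "S \<in> nsets V k - \<F>"
    have "T = S" if "T \<in> \<F>" "T \<subseteq> S" for T
      using that S F(1) by (intro card_subset_eq) (auto simp: nsets_def)
    then show "S \<in> level V k \<B>" using S by (auto simp: level_def \<B>_def nsets_def)
  qed
  then have "card (level V k \<B>) = (n choose k) - card \<F>"
    using F(1) V finite_subset[OF F(1) finN] by (simp add: card_Diff_subset card_nsets)
  moreover have "card \<F> \<le> n choose k" using card_mono[OF finN F(1)] V by (simp add: card_nsets)
  ultimately have "card (level V k \<B>) \<le> ((n - r) choose k) + ((n - r - t) choose (k - 1))"
    using size by linarith
  then have "pmeas p V \<B> \<le> (1 - p) ^ r + (1 - p) ^ t + (\<Sum>l<k. real (n choose l) * (p ^ l * (1 - p) ^ (n - l)))"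
    using p by (intro pmeas_le_of_level_le V dc F(2) rt) auto
  moreover have "(1 - p) ^ t \<le> (5/8) ^ t" using p by (intro power_mono) auto
  ultimately have up: "pmeas p V \<B> \<le> (1 - p) ^ r + \<epsilon>"
    using tail E(2) unfolding p_def[symmetric] \<epsilon>_def by linarith
  have def: "deficit V \<B> \<le> \<epsilon>" by (rule deficit_le[OF \<beta> up])
  have rpos: "(1::real) \<le> 2 ^ r" "(4::real) ^ r = 2 ^ r * 2 ^ r" by (simp_all flip: power_mult_distrib)
  have \<epsilon>0: "0 \<le> 2 ^ r * \<epsilon>" "0 \<le> \<epsilon>" using E by (auto simp: \<epsilon>_def)
  have \<epsilon>\<tau>: "1600 * (2 ^ r * (2 ^ r * \<epsilon>)) \<le> \<tau>" using small by (simp add: rpos(2) \<epsilon>_def algebra_simps)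
  have \<epsilon>1: "2 ^ r * \<epsilon> \<le> 2 ^ r * (2 ^ r * \<epsilon>)" using mult_right_mono[OF rpos(1) \<epsilon>0(1)] by simp
  have "\<exists>R\<subseteq>V. card R = r \<and> 2 ^ r * pmeas (1/2) V \<B>
      \<le> (1 + 18 * (2 ^ r * \<epsilon>) / ((1/2 - p) * (1/2) ^ r)) ^ r * pmeas (1/2) (V - R) \<B>"
  proof (rule exists_codimension_subcube[OF V(1) dc \<beta>])
    show "2 ^ r * pmeas (1/2) V \<B> \<le> 3/2"
    proof (rule half_measure_le[OF V(1) dc up \<epsilon>0(2)])
      show "2 ^ r * \<epsilon> \<le> 1/5" using \<epsilon>1 \<epsilon>\<tau> \<epsilon>0 \<tau> by linarith
    qed
    show "2 ^ r * deficit V \<B> \<le> 2 ^ r * \<epsilon>" using def by simp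
    have "1600 * (2 ^ r * \<epsilon>) \<le> \<tau> * (1/2) ^ r"
      using \<epsilon>\<tau> by (simp add: power_one_over field_simps)
    moreover have "\<tau> * (1/2) ^ r \<le> \<tau> * 1" using \<tau> by (intro mult_left_mono power_le_one) auto
    ultimately have "2 ^ r * \<epsilon> \<le> \<tau> / 200 * (1/2) ^ r" "2 ^ r * \<epsilon> \<le> \<tau> / 200 * (1/8)"
      using \<epsilon>0 \<epsilon>1 \<epsilon>\<tau> by auto
    then show "2 ^ r * \<epsilon> \<le> (1/2 - p) / 200 * min ((1/2) ^ r) (1/8)" unfolding p\<tau> min_def by auto
  qed (use \<epsilon>0 in auto)
  then obtain R where R: "R \<subseteq> V" "card R = r"
    and "2 ^ r * pmeas (1/2) V \<B> \<le> (1 + \<xi>) ^ r * pmeas (1/2) (V - R) \<B>"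
    unfolding p\<tau> \<xi>_def by blast
  moreover have "1 \<le> 2 ^ r * pmeas (1/2) V \<B>"
    using \<beta> by (simp add: power_one_over field_simps)
  ultimately have one_le: "1 \<le> (1 + \<xi>) ^ r * pmeas (1/2) (V - R) \<B>" by linarith
  have \<xi>: "0 \<le> \<xi>" using \<tau> \<epsilon>0 by (simp add: \<xi>_def)
  have fR: "finite R" using R V finite_subset by blast
  have cVR: "card (V - R) = n - r" using R V fR by (simp add: card_Diff_subset)
  \<comment> \<open>From \<open>(1 + \<xi>) ^ r \<le> exp (r * \<xi>)\<close> the measure is at
    least \<open>exp (- r * \<xi>)\<close>.\<close>
  have lower: "1 - real r * \<xi> \<le> pmeas (1/2) (V - R) \<B>"
  proof -
    have "(1 + \<xi>) ^ r \<le> exp \<xi> ^ r" using \<xi> by (intro power_mono exp_ge_add_one_self) auto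
    then have "(1 + \<xi>) ^ r * pmeas (1/2) (V - R) \<B> \<le> exp (real r * \<xi>) * pmeas (1/2) (V - R) \<B>"
      by (intro mult_right_mono pmeas_nonneg) (auto simp: exp_of_nat_mult)
    with one_le have "exp (- (real r * \<xi>)) \<le> pmeas (1/2) (V - R) \<B>"
      by (simp add: exp_minus field_simps)
    then show ?thesis using exp_ge_add_one_self[of "- (real r * \<xi>)"] by linarith
  qed
  define \<G> where "\<G> = {S \<in> \<F>. S \<inter> R = {}}"
  have "pmeas (1/2) (V - R) {T. \<exists>S\<in>\<G>. S \<subseteq> T} \<le> pmeas (1/2) (V - R) (- \<B>)"
    using V by (intro pmeas_mono) (auto simp: \<G>_def \<B>_def)
  then have "pmeas (1/2) (V - R) {T. \<exists>S\<in>\<G>. S \<subseteq> T} \<le> real r * \<xi>"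
    using lower V pmeas_Compl[of "V - R" "1/2" \<B>] by simp
  then have "real ((n - r) choose k) * pmeas (1/2) (V - R) {T. \<exists>S\<in>\<G>. S \<subseteq> T} \<le> real ((n - r) choose k) * (real r * \<xi>)"
    by (intro mult_left_mono) auto
  moreover have "\<G> \<subseteq> nsets (V - R) k" using F(1) by (auto simp: \<G>_def nsets_def)
  then have "real (card \<G>) * (1 - (\<Sum>l<k. real ((n - r) choose l) * ((1/2) ^ l * (1 - 1/2) ^ (n - r - l))))
    \<le> real ((n - r) choose k) * pmeas (1/2) (V - R) {T. \<exists>S\<in>\<G>. S \<subseteq> T}"
    using density_le_pmeas_up[of "V - R" \<G> k "1/2"] V by (simp add: cVR)
  moreover have "real (card \<G>) * (1/2)
    \<le> real (card \<G>) * (1 - (\<Sum>l<k. real ((n - r) choose l) * ((1/2) ^ l * (1 - 1/2) ^ (n - r - l))))"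
  proof (intro mult_left_mono)
    have "E \<le> 4 ^ r * E" using E by simp
    then show "1/2 \<le> 1 - (\<Sum>l<k. real ((n - r) choose l) * ((1/2) ^ l * (1 - 1/2) ^ (n - r - l)))"
      using tail' small \<tau> by linarith
  qed auto
  ultimately have "real (card \<G>) \<le> 2 * real r * \<xi> * real ((n - r) choose k)" by (simp add: algebra_simps)
  \<comment> \<open>Bounding \<open>r\<close> by \<open>2 ^ r\<close> keeps every factor a power of
    two; inserting \<open>\<xi>\<close> then gives \<open>72 = 2 * 18 * 2\<close>.\<close>
  also have "\<dots> \<le> 2 * 2 ^ r * \<xi> * real ((n - r) choose k)"
    using \<xi> of_nat_less_two_power[of r, where 'a = real] by (intro mult_right_mono) auto
  also have "2 * 2 ^ r * \<xi> = 2 ^ r * (72 * 4 ^ r * E / \<tau>)"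
    using \<tau> by (simp add: \<xi>_def \<epsilon>_def rpos(2) power_one_over field_simps)
  finally show ?thesis using R fR by (intro bexI[of _ R]) (auto simp: \<G>_def nsets_def)
qed

section \<open>The remaining cases and the choice of parameters\<close>

lemma pmeas_half: "finite V \<Longrightarrow> pmeas (1/2) V \<B> = real (card {S \<in> \<B>. S \<subseteq> V}) * (1/2) ^ card V"
proof -
  assume V: "finite V"
  have "(1/2::real) ^ card S * (1 - 1/2) ^ (card V - card S) = (1/2) ^ card V" if "S \<subseteq> V" for S
    using card_mono[OF V that] by (simp flip: power_add)
  then show ?thesis by (simp add: pmeas_def)
qed

text \<open>For singletons the sets containing no member of \<open>\<F>\<close> are those avoiding
  its union, of measure \<open>(1/2) ^ card (\<Union>\<F>)\<close>. Hence the union has at most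
  \<open>r\<close> points and extends to \<open>R\<close>.\<close>

lemma exists_cover_of_singletons:
  assumes "finite V" "r \<le> card V" "\<F> \<subseteq> nsets V 1"
    and meas: "pmeas (1/2) V {T. \<exists>S\<in>\<F>. S \<subseteq> T} \<le> 1 - (1/2) ^ r"
  shows "\<exists>R\<in>nsets V r. {S \<in> \<F>. S \<inter> R = {}} = {}"
proof -
  have one: "\<exists>x. S = {x}" if "S \<in> \<F>" for S
    using that assms(3) by (auto simp: nsets_def card_1_singleton_iff)
  have U: "\<Union>\<F> \<subseteq> V" using assms(3) by (auto simp: nsets_def)
  have finU: "finite (\<Union>\<F>)" using U assms(1) finite_subset by blast
  have "{S \<in> - {T. \<exists>S\<in>\<F>. S \<subseteq> T}. S \<subseteq> V} = Pow (V - \<Union>\<F>)"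
    using one by fastforce
  then have "pmeas (1/2) V (- {T. \<exists>S\<in>\<F>. S \<subseteq> T}) = 2 ^ (card V - card (\<Union>\<F>)) * (1/2) ^ card V"
    using assms(1) U finU by (simp add: pmeas_half card_Pow card_Diff_subset)
  also have "\<dots> = (1/2) ^ card (\<Union>\<F>)"
    using card_mono[OF assms(1) U] by (simp add: power_diff power_one_over field_simps)
  finally have "(1/2 :: real) ^ r \<le> (1/2) ^ card (\<Union>\<F>)"
    using meas pmeas_Compl[OF assms(1), of "1/2" "{T. \<exists>S\<in>\<F>. S \<subseteq> T}"] by linarith
  then have "card (\<Union>\<F>) \<le> r" by (simp add: power_decreasing_iff)
  then obtain R where R: "\<Union>\<F> \<subseteq> R" "R \<subseteq> V" "card R = r"
    using exists_subset_between[of "\<Union>\<F>" r V] assms(1,2) U by blast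
  have "{S \<in> \<F>. S \<inter> R = {}} = {}" using one R(1) by fastforce
  then show ?thesis using R assms(1) finite_subset by (intro bexI[of _ R]) (auto simp: nsets_def)
qed

lemma card_avoiding_le:
  assumes "finite V" "\<F> \<subseteq> nsets V k" "R \<in> nsets V r"
  shows "card {S \<in> \<F>. S \<inter> R = {}} \<le> (card V - r) choose k"
proof -
  have "{S \<in> \<F>. S \<inter> R = {}} \<subseteq> nsets (V - R) k" using assms(2) by (auto simp: nsets_def)
  then have "card {S \<in> \<F>. S \<inter> R = {}} \<le> card (V - R) choose k"
    using card_mono[OF finite_imp_finite_nsets, of "V - R"] assms(1) by (simp add: card_nsets)
  then show ?thesis using assms(3) by (auto simp: nsets_def card_Diff_subset)
qed

text \<open>Here \<open>\<Delta>\<close> is the distance from \<open>k\<close> to the middle level.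
  If \<open>\<Delta> \<le> k\<close>, then \<open>n \<le> 4 * k\<close> and the gap hypothesis is
  squared; otherwise \<open>n \<le> 4 * \<Delta>\<close> and \<open>s\<^sup>2 \<le> n\<close>
  suffices. The three bounds serve the tail estimates, the size of \<open>r\<close>, and the size of
  the bias.\<close>

lemma gap_bounds:
  fixes s \<Delta> :: real
  assumes k: "2 \<le> k" and s: "1 \<le> s" "s\<^sup>2 \<le> real n"
    and \<Delta>: "real n = 2 * real k + 2 * \<Delta>" "s * sqrt (real k) \<le> 2 * \<Delta>"
  shows "s\<^sup>2 * real n \<le> 16 * \<Delta>\<^sup>2" and "s\<^sup>2 \<le> 4 * \<Delta>" and "real n \<le> 8 * real k * \<Delta>"
proof -
  have "s * 1 \<le> s * sqrt (real k)" using k s by (intro mult_left_mono) auto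
  then have \<Delta>1: "1/2 \<le> \<Delta>" using s \<Delta> by linarith
  have n0: "0 < real n" using \<Delta> \<Delta>1 by linarith
  have "s\<^sup>2 * real n \<le> 16 * \<Delta>\<^sup>2 \<and> real n \<le> 8 * real k * \<Delta>"
  proof (cases "\<Delta> \<le> real k")
    case True
    have "(s * sqrt (real k))\<^sup>2 \<le> (2 * \<Delta>)\<^sup>2" using \<Delta> s by (intro power_mono) auto
    then have "s\<^sup>2 * real k \<le> 4 * \<Delta>\<^sup>2" by (simp add: power_mult_distrib)
    moreover have "s\<^sup>2 * real n \<le> s\<^sup>2 * (4 * real k)" using True \<Delta> by (intro mult_left_mono) auto
    moreover have "real k * (1/2) \<le> real k * \<Delta>" using \<Delta>1 by (intro mult_left_mono) auto
    then have "real n \<le> 8 * real k * \<Delta>" using True \<Delta>(1) by linarith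
    ultimately show ?thesis by linarith
  next
    case False
    then have n4: "real n \<le> 4 * \<Delta>" using \<Delta> by linarith
    have "s\<^sup>2 * real n \<le> real n * real n" using s by (intro mult_right_mono) auto
    also have "\<dots> \<le> (4 * \<Delta>) * (4 * \<Delta>)" using n4 n0 by (intro mult_mono) auto
    finally have "s\<^sup>2 * real n \<le> 16 * \<Delta>\<^sup>2" by (simp add: power2_eq_square)
    moreover have "4 * \<Delta> \<le> 8 * real k * \<Delta>" using k \<Delta>1 by (intro mult_right_mono) auto
    ultimately show ?thesis using n4 by linarith
  qed
  then show *: "s\<^sup>2 * real n \<le> 16 * \<Delta>\<^sup>2" and "real n \<le> 8 * real k * \<Delta>" by auto
  have "s\<^sup>2 * s\<^sup>2 \<le> s\<^sup>2 * real n" using s by (intro mult_left_mono) auto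
  then have "(s\<^sup>2)\<^sup>2 \<le> (4 * \<Delta>)\<^sup>2" using * by (simp add: power2_eq_square)
  then show "s\<^sup>2 \<le> 4 * \<Delta>" by (rule power2_le_imp_le) (use \<Delta>1 in simp)
qed

text \<open>The mean is still \<open>3/4 * \<Delta>\<close> or more above \<open>k\<close>. The
  Chernoff parameter \<open>\<Delta> / n\<close> makes the exponent at most
  \<open>- \<Delta>\<^sup>2 / (2 * n)\<close>.\<close>

lemma binomial_tail_gap:
  fixes s \<Delta> q :: real
  assumes \<Delta>: "real n = 2 * real k + 2 * \<Delta>" "0 < \<Delta>" "s\<^sup>2 * real n \<le> 16 * \<Delta>\<^sup>2"
    and q: "0 \<le> q" "q \<le> 1" and m: "real n / 2 - \<Delta> / 4 \<le> real m * q" "real m * q \<le> real n / 2"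
  shows "(\<Sum>l<k. real (m choose l) * (q ^ l * (1 - q) ^ (m - l))) \<le> exp (- s\<^sup>2 / 32)"
proof -
  define x where "x = \<Delta> / real n"
  have n0: "0 < real n" using \<Delta> by (simp add: add_nonneg_pos)
  have x: "0 \<le> x" "x \<le> 1" "x * real n = \<Delta>" using \<Delta> n0 by (auto simp: x_def)
  have "x * real k - real m * q * (x - x\<^sup>2 / 2) = x * real k - x * (real m * q) + (real m * q) * (x\<^sup>2 / 2)"
    by (simp add: algebra_simps)
  also have "\<dots> \<le> x * real k - x * (real n / 2 - \<Delta> / 4) + (real n / 2) * (x\<^sup>2 / 2)"
    using m x by (intro add_mono diff_mono mult_left_mono mult_right_mono) auto
  also have "\<dots> = - (x * \<Delta>) / 2"
  proof -
    have k: "real k = real n / 2 - \<Delta>" using \<Delta>(1) by (simp add: add_divide_distrib)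
    have "x * real k - x * (real n / 2 - \<Delta> / 4) = - 3 / 4 * (x * \<Delta>)"
      unfolding k by (simp add: algebra_simps)
    moreover have "(real n / 2) * (x\<^sup>2 / 2) = (x * real n) * x / 4" by (simp add: power2_eq_square)
    ultimately show ?thesis unfolding x(3) by simp
  qed
  also have "\<dots> \<le> - s\<^sup>2 / 32"
  proof -
    have "s\<^sup>2 \<le> 16 * (x * \<Delta>)" using \<Delta>(3) n0 by (simp add: x_def field_simps power2_eq_square)
    then show ?thesis by simp
  qed
  finally have "x * real k - real m * q * (x - x\<^sup>2 / 2) \<le> - s\<^sup>2 / 32" .
  then have "exp (x * real k - real m * q * (x - x\<^sup>2 / 2)) \<le> exp (- s\<^sup>2 / 32)" by simp
  with binomial_lower_tail_le[OF q x(1), of m k] show ?thesis by linarith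
qed

text \<open>Everything is measured by \<open>y = s\<^sup>2 / 1024\<close>, which is at least 1:
  \<open>131072 = 2 ^ 17\<close>, \<open>4 ^ r\<close> and \<open>k\<close> are at most
  \<open>exp (17 * y)\<close>, \<open>exp (8 * y)\<close> and \<open>exp y\<close>, against
  \<open>exp (- 32 * y)\<close>.\<close>

lemma key_estimate:
  fixes s :: real
  assumes k: "2 \<le> k" and s: "32 * sqrt (log 2 (real k)) \<le> s" and r: "2 ^ r < exp (s\<^sup>2 / 256)"
  shows "131072 * 4 ^ r * real k * exp (- s\<^sup>2 / 32) \<le> exp (- s\<^sup>2 / 256)" and "32 \<le> s"
proof -
  have log1: "1 \<le> log 2 (real k)" using k by simp
  then have "32 * 1 \<le> 32 * sqrt (log 2 (real k))" by (intro mult_left_mono) auto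
  then show s32: "32 \<le> s" using s by linarith
  have "(32 * sqrt (log 2 (real k)))\<^sup>2 \<le> s\<^sup>2" using s log1 by (intro power_mono) auto
  then have sq: "1024 * log 2 (real k) \<le> s\<^sup>2" using log1 by (simp add: power_mult_distrib)
  define y where "y = s\<^sup>2 / 1024"
  have y: "1 \<le> y" "log 2 (real k) \<le> y" using sq log1 by (auto simp: y_def)
  have two: "(2::real) \<le> exp 1" using exp_ge_add_one_self[of 1] by simp
  have "real k = 2 powr (log 2 (real k))" using k by simp
  also have "\<dots> \<le> 2 powr y" using y by (intro powr_mono) auto
  also have "\<dots> \<le> exp 1 powr y" using two y by (intro powr_mono2) auto
  also have "\<dots> = exp y" by (simp add: powr_def)
  finally have ky: "real k \<le> exp y" .
  have "131072 = (2::real) ^ 17" by simp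
  also have "\<dots> \<le> exp 1 ^ 17" using two by (intro power_mono) auto
  also have "\<dots> = exp (17 * 1)" by (subst exp_of_nat_mult[symmetric]) simp
  also have "\<dots> \<le> exp (17 * y)" using y by simp
  finally have cy: "131072 \<le> exp (17 * y)" .
  have "(4::real) ^ r = 2 ^ r * 2 ^ r" by (simp flip: power_mult_distrib)
  also have "\<dots> \<le> exp (s\<^sup>2 / 256) * exp (s\<^sup>2 / 256)" using r by (intro mult_mono) auto
  also have "\<dots> = exp (8 * y)" by (simp add: y_def flip: exp_add)
  finally have ry: "4 ^ r \<le> exp (8 * y)" .
  have "131072 * 4 ^ r * real k \<le> exp (17 * y) * exp (8 * y) * exp y"
    using cy ry ky by (intro mult_mono) auto
  also have "\<dots> = exp (26 * y)" by (simp flip: exp_add)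
  finally have "131072 * 4 ^ r * real k * exp (- s\<^sup>2 / 32) \<le> exp (26 * y) * exp (- s\<^sup>2 / 32)"
    by (intro mult_right_mono) auto
  also have "\<dots> = exp (26 * y - 32 * y)" by (simp add: y_def flip: exp_add)
  also have "\<dots> \<le> exp (- s\<^sup>2 / 256)"
  proof -
    have "- s\<^sup>2 / 256 = - 4 * y" by (simp add: y_def)
    then show ?thesis using y by simp
  qed
  finally show "131072 * 4 ^ r * real k * exp (- s\<^sup>2 / 32) \<le> exp (- s\<^sup>2 / 256)" .
qed

theorem theorem1p5:
  "\<exists>C\<^sub>0 c :: real. C\<^sub>0 > 0 \<and> c > 0 \<and>
     (\<forall>(r::nat) (k::nat) (s::real) (t::nat) (n::nat) (\<F> :: nat set set).
        k \<ge> 1 \<longrightarrow>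
        s \<ge> C\<^sub>0 * sqrt (log 2 (real k)) \<longrightarrow>
        real t \<ge> s\<^sup>2 \<longrightarrow>
        real n \<ge> 2 * real k + s * sqrt (real k) \<longrightarrow>
        r + t \<le> n \<longrightarrow>
        \<F> \<subseteq> nsets {1..n} k \<longrightarrow>
        biased_measure n (1 / 2) (up_closure n \<F>) \<le> 1 - 1 / 2 ^ r \<longrightarrow>
        real (card \<F>) \<ge> real (n choose k) - real ((n - r) choose k)
                           - real ((n - r - t) choose (k - 1)) \<longrightarrow>
        (\<exists>R \<in> nsets {1..n} r.
           real (card {S \<in> \<F>. S \<inter> R = {}})
             \<le> 2 ^ r * exp (- c * s\<^sup>2) * real ((n - r) choose k)))"
proof (rule exI[of _ 32], rule exI[of _ "1/256"], intro conjI allI impI)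
  fix r k :: nat and s :: real and t n :: nat and \<F> :: "nat set set"
  assume k1: "k \<ge> 1" and s: "s \<ge> 32 * sqrt (log 2 (real k))" and t: "real t \<ge> s\<^sup>2"
    and n: "real n \<ge> 2 * real k + s * sqrt (real k)" and rt: "r + t \<le> n" and F: "\<F> \<subseteq> nsets {1..n} k"
    and meas: "biased_measure n (1 / 2) (up_closure n \<F>) \<le> 1 - 1 / 2 ^ r"
    and size: "real (card \<F>) \<ge> real (n choose k) - real ((n - r) choose k) - real ((n - r - t) choose (k - 1))"
  define V where "V = {1..n}"
  have V: "finite V" "card V = n" by (auto simp: V_def)
  have rn: "r \<le> n" using rt by simp
  have meas': "pmeas (1/2) V {T. \<exists>S\<in>\<F>. S \<subseteq> T} \<le> 1 - (1/2) ^ r"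
  proof -
    have "up_closure n \<F> = {T \<in> {T. \<exists>S\<in>\<F>. S \<subseteq> T}. T \<subseteq> V}"
      using F by (subst up_closure_eq) (auto simp: nsets_def V_def)
    then show ?thesis using meas V unfolding biased_measure_def pmeas_def by (simp add: power_one_over)
  qed
  show "\<exists>R \<in> nsets {1..n} r. real (card {S \<in> \<F>. S \<inter> R = {}})
     \<le> 2 ^ r * exp (- (1/256) * s\<^sup>2) * real ((n - r) choose k)"
  proof (cases "1 \<le> 2 ^ r * exp (- (1/256) * s\<^sup>2)")
    case True
    \<comment> \<open>In this case the claimed bound is at least the number of all
      \<open>k\<close>-sets avoiding \<open>R\<close>, so every \<open>r\<close>-set will
      do.\<close>
    obtain R where R: "R \<subseteq> V" "card R = r" "finite R"
      using obtain_subset_with_card_n[of r V] rn V by auto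
    then have "R \<in> nsets V r" by (auto simp: nsets_def)
    have "real (card {S \<in> \<F>. S \<inter> R = {}}) \<le> 1 * real ((n - r) choose k)"
      using card_avoiding_le[OF V(1) F[folded V_def] \<open>R \<in> nsets V r\<close>] V by simp
    also have "\<dots> \<le> 2 ^ r * exp (- (1/256) * s\<^sup>2) * real ((n - r) choose k)"
      using True by (intro mult_right_mono) auto
    finally show ?thesis using \<open>R \<in> nsets V r\<close> unfolding V_def by (intro bexI[of _ R])
  next
    case False
    \<comment> \<open>At \<open>k = 1\<close> the logarithm vanishes and gives no positive lower
      bound on \<open>s\<close>, and the cascade argument starts at \<open>k = 2\<close>.\<close>
    show ?thesis
    proof (cases "k = 1")
      case True
      have "\<exists>R\<in>nsets V r. {S \<in> \<F>. S \<inter> R = {}} = {}"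
        using F True rn V by (intro exists_cover_of_singletons meas') (auto simp: V_def)
      then obtain R where R: "R \<in> nsets V r" "{S \<in> \<F>. S \<inter> R = {}} = {}" by blast
      show ?thesis unfolding V_def[symmetric] by (rule bexI[OF _ R(1)]) (simp add: R(2))
    next
      case k_ne: False
      then have k: "2 \<le> k" using k1 by simp
      define E where "E = exp (- s\<^sup>2 / 32)"
      define \<Delta> where "\<Delta> = real n / 2 - real k"
      \<comment> \<open>With this bias the mean \<open>n * (1/2 - \<tau>)\<close> is
        \<open>n / 2 - \<Delta> / 4\<close>, still well above
        \<open>k = n / 2 - \<Delta>\<close>.\<close>
      define \<tau> where "\<tau> = \<Delta> / (4 * real n)"
      have r: "2 ^ r < exp (s\<^sup>2 / 256)" using False by (simp add: exp_minus field_simps)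
      note key = key_estimate[OF k s r]
      have \<Delta>: "real n = 2 * real k + 2 * \<Delta>" "s * sqrt (real k) \<le> 2 * \<Delta>" using n by (auto simp: \<Delta>_def)
      have sn: "s\<^sup>2 \<le> real n" using t rt by linarith
      have s1: "1 \<le> s" using key(2) by simp
      note gap = gap_bounds[OF k s1 sn \<Delta>]
      have "1 \<le> s\<^sup>2" using s1 by simp
      then have \<Delta>0: "0 < \<Delta>" and "1 \<le> real t" using gap(2) t by linarith+
      then have t1: "1 \<le> t" by simp
      have n0: "0 < real n" using \<Delta>(1) \<Delta>0 by (simp add: add_nonneg_pos)
      have \<tau>: "0 < \<tau>" "\<tau> \<le> 1/8" "1 \<le> 32 * real k * \<tau>"
        using \<Delta>0 n0 \<Delta>(1) gap(3) unfolding \<tau>_def by (simp, simp add: divide_le_eq, simp add: le_divide_eq)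
      \<comment> \<open>This moves the mean \<open>(n - r) / 2\<close> of the second tail down by at
        most \<open>\<Delta> / 4\<close>, as \<open>binomial_tail_gap\<close> allows.\<close>
      have rs: "real r \<le> \<Delta> / 2"
      proof -
        have "exp (real r * (1/2)) = exp (1/2) ^ r" by (rule exp_of_nat_mult)
        also have "\<dots> \<le> 2 ^ r"
        proof (rule power_mono)
          have "exp (1/2 :: real) \<le> 1 + 1/2 + (1/2)\<^sup>2" by (rule exp_bound) auto
          then show "exp (1/2 :: real) \<le> 2" by (simp add: power2_eq_square)
        qed auto
        also have "\<dots> < exp (s\<^sup>2 / 256)" by (rule r)
        finally have "real r \<le> s\<^sup>2 / 128" by simp
        then show ?thesis using gap(2) \<Delta>0 by simp
      qed
      have "\<exists>R\<in>nsets V r. real (card {S \<in> \<F>. S \<inter> R = {}}) \<le> 2 ^ r * (72 * 4 ^ r * E / \<tau>) * real ((n - r) choose k)"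
      proof (rule exists_removal_set[OF V F[folded V_def] k rt t1 \<tau>(1,2) _ _ _ _ _ meas' size])
        show "0 < E" by (simp add: E_def)
        have "(5/8 :: real) \<le> exp (- 3/8)" using exp_ge_add_one_self[of "- 3/8 :: real"] by simp
        then have "(5/8 :: real) ^ t \<le> exp (- 3/8) ^ t" by (intro power_mono) auto
        also have "\<dots> = exp (real t * (- 3/8))" by (rule exp_of_nat_mult[symmetric])
        also have "\<dots> \<le> E" using t by (simp add: E_def)
        finally show "(5/8) ^ t \<le> E" .
        have "real n * (1/2 - \<tau>) = real n / 2 - \<Delta> / 4" using n0 by (simp add: \<tau>_def field_simps)
        then show "(\<Sum>l<k. real (n choose l) * ((1/2 - \<tau>) ^ l * (1 - (1/2 - \<tau>)) ^ (n - l))) \<le> E"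
          unfolding E_def using \<tau> \<Delta>0 by (intro binomial_tail_gap[OF \<Delta>(1) \<Delta>0 gap(1)]) auto
        show "(\<Sum>l<k. real ((n - r) choose l) * ((1/2) ^ l * (1 - 1/2) ^ (n - r - l))) \<le> E"
          unfolding E_def using rs rn by (intro binomial_tail_gap[OF \<Delta>(1) \<Delta>0 gap(1)]) auto
        \<comment> \<open>The bound \<open>1 \<le> 32 * k * \<tau>\<close> trades
          \<open>1 / \<tau>\<close> for a multiple of \<open>k\<close>, which the hypothesis on
          \<open>s\<close> absorbs; \<open>2 * 1600 * 32 = 102400\<close> is below
          \<open>2 ^ 17\<close>.\<close>
        have "4 ^ r * (2 * E) * 1600 * 1 \<le> 4 ^ r * (2 * E) * 1600 * (32 * real k * \<tau>)"
          using \<tau> by (intro mult_left_mono) (auto simp: E_def)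
        also have "\<dots> = (102400 * 4 ^ r * real k * E) * \<tau>" by simp
        also have "\<dots> \<le> 1 * \<tau>"
        proof (intro mult_right_mono)
          have "102400 * (4 ^ r * real k * E) \<le> 131072 * (4 ^ r * real k * E)"
            by (intro mult_right_mono) (auto simp: E_def)
          also have "\<dots> \<le> exp (- s\<^sup>2 / 256)" using key(1) by (simp add: E_def mult.assoc)
          also have "\<dots> \<le> 1" by simp
          finally show "102400 * 4 ^ r * real k * E \<le> 1" by (simp add: mult.assoc)
        qed (use \<tau> in auto)
        finally show "4 ^ r * (2 * E) * 1600 \<le> \<tau>" by simp
      qed
      then obtain R where R: "R \<in> nsets V r"
        "real (card {S \<in> \<F>. S \<inter> R = {}}) \<le> 2 ^ r * (72 * 4 ^ r * E / \<tau>) * real ((n - r) choose k)" by blast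
      have "72 * 4 ^ r * E / \<tau> \<le> exp (- (1/256) * s\<^sup>2)"
      proof -
        have "72 * 4 ^ r * E * 1 \<le> 72 * 4 ^ r * E * (32 * real k * \<tau>)"
          using \<tau> by (intro mult_left_mono) (auto simp: E_def)
        then have "72 * 4 ^ r * E / \<tau> \<le> 2304 * (4 ^ r * real k * E)" using \<tau> by (simp add: divide_le_eq mult_ac)
        also have "\<dots> \<le> 131072 * (4 ^ r * real k * E)"
          by (intro mult_right_mono) (auto simp: E_def)
        also have "\<dots> \<le> exp (- (1/256) * s\<^sup>2)" using key(1) by (simp add: E_def mult.assoc)
        finally show ?thesis .
      qed
      then have "2 ^ r * (72 * 4 ^ r * E / \<tau>) * real ((n - r) choose k)
        \<le> 2 ^ r * exp (- (1/256) * s\<^sup>2) * real ((n - r) choose k)"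
        by (intro mult_right_mono mult_left_mono) auto
      then show ?thesis using R unfolding V_def by (intro bexI[of _ R]) auto
    qed
  qed
qed auto

end
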